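(* For every graph $G$ with at least one vertex and every $S\subseteq V(G)$, \[\operatorname{tn}(G,S)-1\leq \operatorname{tw}(G,S)\leq 10\max\{\operatorname{tn}(G,S),2\}-12.\]
   Context: A separation of $G$ is a pair $(A,B)$ of subgraphs of $G$ with $A\cup B=G$ and $E(A\cap B)=\emptyset$; its order is $|V(A)\cap V(B)|$. For a positive integer $k$, a tangle of order $k$ in $G$ is a family $\mathcal T$ of separations of $G$ of order less than $k$ such that: (T1) for every separation $(A,B)$ of order at most $k-1$, $(A,B)\in\mathcal T$ or $(B,A)\in\mathcal T$; (T2) for all $(A_1,B_1),(A_2,B_2),(A_3,B_3)\in\mathcal T$, $A_1\cup A_2\cup A_3\neq G$; (T3) for every $(A,B)\in\mathcal T$, $V(A)\ne V(G)$. It is a tangle of $(G,S)$ if moreover (T4) for every $(A,B)\in\mathcal T$, $S\not\subseteq V(A)$. $\operatorname{tn}(G,S)$ is the maximum order of a tangle of $(G,S)$. A tree decomposition of a graph $H$ is a pair $(T,(W_x\mid x\in V(T)))$ with $T$ a non-null tree and bags $W_x\subseteq V(H)$ such that each edge of $H$ lies in some bag and for each vertex $v$ the set $\{x: v\in W_x\}$ induces a non-empty subtree; its width is $\max_x|W_x|-1$. A tree decomposition of $(G,S)$ is a tree decomposition $\mathcal B$ of some induced subgraph $H$ of $G$ with $S\subseteq V(H)$ such that for every component $C$ of $G-V(H)$ some bag of $\mathcal B$ contains all neighbours of $V(C)$ in $G$. $\operatorname{tw}(G,S)$ is the minimum width of a tree decomposition of $(G,S)$. *)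

theory Defs
  imports Main
begin

section \<open>Finite simple graphs\<close>

record 'a ugraph =
  verts :: "'a set"
  edges :: "'a set set"

definition simple_graph :: "'a ugraph \<Rightarrow> bool" where
  "simple_graph G \<longleftrightarrow> finite (verts G) \<and> (\<forall>e\<in>edges G. e \<subseteq> verts G \<and> card e = 2)"

definition subgraph :: "'a ugraph \<Rightarrow> 'a ugraph \<Rightarrow> bool" where
  "subgraph A G \<longleftrightarrow> simple_graph A \<and> verts A \<subseteq> verts G \<and> edges A \<subseteq> edges G"

definition graph_union :: "'a ugraph \<Rightarrow> 'a ugraph \<Rightarrow> 'a ugraph" where
  "graph_union A B = \<lparr>verts = verts A \<union> verts B, edges = edges A \<union> edges B\<rparr>"

definition graph_inter :: "'a ugraph \<Rightarrow> 'a ugraph \<Rightarrow> 'a ugraph" where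
  "graph_inter A B = \<lparr>verts = verts A \<inter> verts B, edges = edges A \<inter> edges B\<rparr>"

definition induced :: "'a ugraph \<Rightarrow> 'a set \<Rightarrow> 'a ugraph" where
  "induced G U = \<lparr>verts = verts G \<inter> U, edges = {e \<in> edges G. e \<subseteq> U}\<rparr>"

definition induced_subgraph :: "'a ugraph \<Rightarrow> 'a ugraph \<Rightarrow> bool" where
  "induced_subgraph H G \<longleftrightarrow> (\<exists>U\<subseteq>verts G. H = induced G U)"

definition delete_verts :: "'a ugraph \<Rightarrow> 'a set \<Rightarrow> 'a ugraph" where
  "delete_verts G X = induced G (verts G - X)"

definition neighbours :: "'a ugraph \<Rightarrow> 'a set \<Rightarrow> 'a set" where
  "neighbours G X = {v \<in> verts G - X. \<exists>u\<in>X. {u, v} \<in> edges G}"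

text \<open>The null graph is not connected, so components and trees are non-null.\<close>

definition graph_connected :: "'a ugraph \<Rightarrow> bool" where
  "graph_connected G \<longleftrightarrow> verts G \<noteq> {} \<and>
     (\<forall>u\<in>verts G. \<forall>v\<in>verts G. (u, v) \<in> {(x, y). {x, y} \<in> edges G}\<^sup>*)"

definition component :: "'a ugraph \<Rightarrow> 'a ugraph \<Rightarrow> bool" where
  "component C G \<longleftrightarrow> subgraph C G \<and> graph_connected C \<and>
     (\<forall>D. subgraph D G \<and> graph_connected D \<and> subgraph C D \<longrightarrow> D = C)"

definition is_cycle :: "'a ugraph \<Rightarrow> 'a list \<Rightarrow> bool" where
  "is_cycle G vs \<longleftrightarrow> 3 \<le> length vs \<and> distinct vs \<and>
     (\<forall>i<length vs. {vs ! i, vs ! (Suc i mod length vs)} \<in> edges G)"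

definition is_tree :: "'a ugraph \<Rightarrow> bool" where
  "is_tree T \<longleftrightarrow> simple_graph T \<and> graph_connected T \<and> (\<nexists>vs. is_cycle T vs)"

section \<open>Tangles\<close>

definition separation :: "'a ugraph \<Rightarrow> 'a ugraph \<Rightarrow> 'a ugraph \<Rightarrow> bool" where
  "separation G A B \<longleftrightarrow> subgraph A G \<and> subgraph B G \<and>
     graph_union A B = G \<and> edges (graph_inter A B) = {}"

definition sep_order :: "'a ugraph \<Rightarrow> 'a ugraph \<Rightarrow> nat" where
  "sep_order A B = card (verts A \<inter> verts B)"

definition tangle :: "'a ugraph \<Rightarrow> nat \<Rightarrow> ('a ugraph \<times> 'a ugraph) set \<Rightarrow> bool" where
  "tangle G k \<T> \<longleftrightarrow>
     1 \<le> k \<and>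
     (\<forall>(A, B)\<in>\<T>. separation G A B \<and> sep_order A B < k) \<and>
     (\<forall>A B. separation G A B \<and> sep_order A B \<le> k - 1 \<longrightarrow> (A, B) \<in> \<T> \<or> (B, A) \<in> \<T>) \<and>
     (\<forall>(A\<^sub>1, B\<^sub>1)\<in>\<T>. \<forall>(A\<^sub>2, B\<^sub>2)\<in>\<T>. \<forall>(A\<^sub>3, B\<^sub>3)\<in>\<T>.
        graph_union (graph_union A\<^sub>1 A\<^sub>2) A\<^sub>3 \<noteq> G) \<and>
     (\<forall>(A, B)\<in>\<T>. verts A \<noteq> verts G)"

definition rooted_tangle ::
  "'a ugraph \<Rightarrow> 'a set \<Rightarrow> nat \<Rightarrow> ('a ugraph \<times> 'a ugraph) set \<Rightarrow> bool" where
  "rooted_tangle G S k \<T> \<longleftrightarrow> tangle G k \<T> \<and> (\<forall>(A, B)\<in>\<T>. \<not> S \<subseteq> verts A)"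

text \<open>If \<open>S\<close> is empty, then \<open>(G, S)\<close> has no tangle at all; the inserted \<open>0\<close> fixes the
  tangle number to be \<open>0\<close> in that case. Tangle orders are at most the number of vertices,
  by \<open>tangle_order_le_card\<close> below, so that the maximum is taken over a finite set.\<close>

definition tangle_number :: "'a ugraph \<Rightarrow> 'a set \<Rightarrow> nat" where
  "tangle_number G S = Max (insert 0 {k. \<exists>\<T>. rooted_tangle G S k \<T>})"

lemma tangle_order_le_card:
  assumes "simple_graph G" "tangle G k \<T>"
  shows "k \<le> card (verts G)"
proof (rule ccontr)
  assume k: "\<not> k \<le> card (verts G)"
  let ?A = "\<lparr>verts = verts G, edges = {}\<rparr>"
  have "separation G ?A G" "sep_order ?A G \<le> k - 1"
    using assms(1) k
    by (auto simp: separation_def subgraph_def simple_graph_def graph_union_def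
        graph_inter_def sep_order_def)
  then have "(?A, G) \<in> \<T> \<or> (G, ?A) \<in> \<T>"
    using assms(2) unfolding tangle_def by blast
  then show False
    using assms(2) unfolding tangle_def by auto
qed

section \<open>Tree decompositions\<close>

definition tree_decomposition :: "'a ugraph \<Rightarrow> 'b ugraph \<Rightarrow> ('b \<Rightarrow> 'a set) \<Rightarrow> bool" where
  "tree_decomposition H T W \<longleftrightarrow>
     is_tree T \<and>
     (\<forall>x\<in>verts T. W x \<subseteq> verts H) \<and>
     (\<forall>e\<in>edges H. \<exists>x\<in>verts T. e \<subseteq> W x) \<and>
     (\<forall>v\<in>verts H. is_tree (induced T {x \<in> verts T. v \<in> W x}))"

definition rooted_tree_decomposition ::
  "'a ugraph \<Rightarrow> 'a set \<Rightarrow> 'b ugraph \<Rightarrow> ('b \<Rightarrow> 'a set) \<Rightarrow> bool" where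
  "rooted_tree_decomposition G S T W \<longleftrightarrow>
     (\<exists>H. induced_subgraph H G \<and> S \<subseteq> verts H \<and> tree_decomposition H T W \<and>
        (\<forall>C. component C (delete_verts G (verts H)) \<longrightarrow>
           (\<exists>x\<in>verts T. neighbours G (verts C) \<subseteq> W x)))"

text \<open>The width is an integer: it equals \<open>-1\<close> if all bags are empty.\<close>

definition width :: "'b ugraph \<Rightarrow> ('b \<Rightarrow> 'a set) \<Rightarrow> int" where
  "width T W = Max ((\<lambda>x. int (card (W x))) ` verts T) - 1"

text \<open>As trees are finite, decomposition trees may be taken on natural numbers.\<close>

definition treewidth :: "'a ugraph \<Rightarrow> 'a set \<Rightarrow> int" where
  "treewidth G S =
     Min {w. \<exists>(T :: nat ugraph) W. rooted_tree_decomposition G S T W \<and> w = width T W}"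

lemma rooted_tree_decomposition_width_bounds:
  assumes "simple_graph G" "rooted_tree_decomposition G S T W"
  shows "-1 \<le> width T W" "width T W \<le> int (card (verts G)) - 1"
proof -
  have fin: "finite (verts G)"
    using assms(1) by (simp add: simple_graph_def)
  have T: "finite (verts T)" "verts T \<noteq> {}"
    using assms(2)
    by (auto simp: rooted_tree_decomposition_def tree_decomposition_def is_tree_def
        simple_graph_def graph_connected_def)
  have "verts H \<subseteq> verts G" if "induced_subgraph H G" for H
    using that by (auto simp: induced_subgraph_def induced_def)
  then have W: "\<forall>x\<in>verts T. W x \<subseteq> verts G"
    using assms(2) unfolding rooted_tree_decomposition_def tree_decomposition_def
    by (meson subset_trans)
  have "\<forall>x\<in>verts T. card (W x) \<le> card (verts G)"
    using W fin card_mono by blast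
  then have "Max ((\<lambda>x. int (card (W x))) ` verts T) \<le> int (card (verts G))"
    using T by simp
  then show "width T W \<le> int (card (verts G)) - 1"
    by (simp add: width_def)
  obtain x where "x \<in> verts T"
    using T by blast
  then have "0 \<le> Max ((\<lambda>x. int (card (W x))) ` verts T)"
    using T by (meson Max_ge_iff finite_imageI image_eqI image_is_empty of_nat_0_le_iff)
  then show "-1 \<le> width T W"
    by (simp add: width_def)
qed

lemma ex_rooted_tree_decomposition:
  assumes "simple_graph G" "S \<subseteq> verts G"
  shows "\<exists>(T :: nat ugraph) W. rooted_tree_decomposition G S T W"
proof -
  let ?T = "\<lparr>verts = {0}, edges = {}\<rparr> :: nat ugraph"
  have "\<not> is_cycle ?T vs" for vs
  proof
    assume "is_cycle ?T vs"
    then have "3 \<le> length vs" "\<forall>i<length vs. False"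
      unfolding is_cycle_def by simp_all
    then show False
      by (metis not_numeral_le_zero gr0I)
  qed
  then have tree: "is_tree ?T"
    by (simp add: is_tree_def simple_graph_def graph_connected_def)
  have G: "induced G (verts G) = G"
    using assms(1) by (cases G) (auto simp: induced_def simple_graph_def)
  have 1: "induced_subgraph G G"
    using G unfolding induced_subgraph_def by (metis order_refl)
  have "induced ?T {x \<in> verts ?T. v \<in> verts G} = ?T" if "v \<in> verts G" for v
    using that by (simp add: induced_def)
  then have 2: "tree_decomposition G ?T (\<lambda>_. verts G)"
    unfolding tree_decomposition_def using assms(1) tree by (simp add: simple_graph_def)
  have 3: "\<not> component C (delete_verts G (verts G))" for C
    by (auto simp: component_def delete_verts_def induced_def subgraph_def graph_connected_def)
  show ?thesis
    unfolding rooted_tree_decomposition_def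
    by (rule exI[of _ ?T], rule exI[of _ "\<lambda>_. verts G"], rule exI[of _ G])
      (simp add: 1 2 3 assms(2))
qed

end

theory Submission
  imports Defs
begin

text \<open>Upper bound: let \<open>k\<close> be such that \<open>(G, S)\<close> has no tangle of order \<open>k + 1\<close>. For every set \<open>Z\<close>
  of at most \<open>3 k + 1\<close> vertices, induction on the number of vertices gives a decomposition with
  bags of size at most \<open>4 k + 1\<close> whose root bag contains \<open>Z\<close>. Indeed, if \<open>Z\<close> has exactly
  \<open>3 k + 1\<close> vertices, then there is a separation of order at most \<open>k\<close> that either has more than
  \<open>k\<close> vertices of \<open>Z\<close> on both sides, or has \<open>S\<close> and at most \<open>k\<close> vertices of \<open>Z\<close> on one side;
  one decomposes the sides (in the latter case only the side of \<open>S\<close>, the other one is discarded)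
  and glues at a new root bag consisting of \<open>Z\<close> and the separator. For \<open>k \<ge> 2\<close> the width \<open>4 k\<close>
  is at most \<open>10 k - 12\<close>.

  Lower bound: for a tangle of \<open>(G, S)\<close> whose order exceeds all bag sizes, each bag together with
  the components attached to it is a small side, because the other side contains \<open>S\<close>. Deleting
  leaves of the decomposition tree one by one preserves this until the whole graph is small.\<close>

section \<open>Components\<close>

definition adj :: "'a ugraph \<Rightarrow> ('a \<times> 'a) set" where
  "adj G = {(x, y). {x, y} \<in> edges G}"

text \<open>Where \<open>component\<close> asks for a maximal connected subgraph, the explicit
  reachability form is a function of a vertex, so that something can be chosen for each component
  and read off at each of its vertices.\<close>

definition component_of :: "'a ugraph \<Rightarrow> 'a \<Rightarrow> 'a ugraph" where
  "component_of G u = induced G {v. (u, v) \<in> (adj G)\<^sup>*}"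

lemma graph_connected_adj:
  "graph_connected G \<longleftrightarrow>
     verts G \<noteq> {} \<and> (\<forall>u\<in>verts G. \<forall>v\<in>verts G. (u, v) \<in> (adj G)\<^sup>*)"
  by (simp add: graph_connected_def adj_def)

lemma sym_adj: "sym (adj G)"
  by (auto simp: sym_def adj_def insert_commute)

lemma adj_rtrancl_sym: "(u, v) \<in> (adj G)\<^sup>* \<Longrightarrow> (v, u) \<in> (adj G)\<^sup>*"
  using sym_rtrancl[OF sym_adj] by (meson symE)

lemma simple_graph_edgeD:
  assumes "simple_graph G" "{u, v} \<in> edges G"
  shows "u \<in> verts G" "v \<in> verts G" "u \<noteq> v"
proof -
  have "{u, v} \<subseteq> verts G" "card {u, v} = 2"
    using assms unfolding simple_graph_def by blast+
  then show "u \<in> verts G" "v \<in> verts G" "u \<noteq> v"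
    by auto
qed

lemma simple_graph_edge_obtain:
  assumes "simple_graph G" "e \<in> edges G"
  obtains u v where "e = {u, v}" "u \<in> verts G" "v \<in> verts G" "u \<noteq> v"
proof -
  have "e \<subseteq> verts G" "card e = 2"
    using assms unfolding simple_graph_def by blast+
  then show ?thesis
    using that by (auto simp: card_2_iff)
qed

lemma verts_induced [simp]: "verts (induced G U) = verts G \<inter> U"
  and edges_induced [simp]: "edges (induced G U) = {e \<in> edges G. e \<subseteq> U}"
  by (simp_all add: induced_def)

lemma simple_graph_induced: "simple_graph G \<Longrightarrow> simple_graph (induced G U)"
  by (auto simp: simple_graph_def)

lemma verts_delete_verts [simp]: "verts (delete_verts G X) = verts G - X"
  and edges_delete_verts [simp]: "edges (delete_verts G X) = {e \<in> edges G. e \<subseteq> verts G - X}"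
  by (auto simp: delete_verts_def)

lemma simple_graph_delete_verts: "simple_graph G \<Longrightarrow> simple_graph (delete_verts G X)"
  by (simp add: delete_verts_def simple_graph_induced)

lemma adj_rtrancl_mono:
  assumes "edges D \<subseteq> edges G" "(u, v) \<in> (adj D)\<^sup>*"
  shows "(u, v) \<in> (adj G)\<^sup>*"
proof -
  have "adj D \<subseteq> adj G"
    using assms(1) by (auto simp: adj_def)
  then show ?thesis
    using assms(2) rtrancl_mono by blast
qed

text \<open>Every vertex on a walk from \<open>u\<close> is itself reachable from \<open>u\<close>,
  so the whole walk survives in the component.\<close>

lemma adj_component_of:
  assumes "(u, v) \<in> (adj G)\<^sup>*"
  shows "(u, v) \<in> (adj (component_of G u))\<^sup>*"
  using assms
proof (induction rule: rtrancl_induct)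
  case base
  then show ?case by simp
next
  case (step y z)
  have "(u, z) \<in> (adj G)\<^sup>*"
    using step.hyps by (rule rtrancl_into_rtrancl)
  then have "(y, z) \<in> adj (component_of G u)"
    using step.hyps by (auto simp: adj_def component_of_def)
  then show ?case
    using step.IH by (rule rtrancl_into_rtrancl[rotated])
qed

lemma graph_connected_component_of:
  assumes "u \<in> verts G"
  shows "graph_connected (component_of G u)"
  unfolding graph_connected_adj
proof (intro conjI ballI)
  show "verts (component_of G u) \<noteq> {}"
    using assms by (auto simp: component_of_def)
  fix x y
  assume "x \<in> verts (component_of G u)" "y \<in> verts (component_of G u)"
  then have "(u, x) \<in> (adj G)\<^sup>*" "(u, y) \<in> (adj G)\<^sup>*"
    by (auto simp: component_of_def)
  then have "(u, x) \<in> (adj (component_of G u))\<^sup>*" "(u, y) \<in> (adj (component_of G u))\<^sup>*"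
    by (auto intro: adj_component_of)
  then show "(x, y) \<in> (adj (component_of G u))\<^sup>*"
    by (meson adj_rtrancl_sym rtrancl_trans)
qed

lemma subgraph_component_of: "simple_graph G \<Longrightarrow> subgraph (component_of G u) G"
  by (auto simp: subgraph_def component_of_def simple_graph_induced)

lemma connected_subgraph_component_of:
  assumes "subgraph D G" "graph_connected D" "u \<in> verts D"
  shows "subgraph D (component_of G u)"
proof -
  have D: "simple_graph D" "verts D \<subseteq> verts G" "edges D \<subseteq> edges G"
    using assms(1) by (auto simp: subgraph_def)
  have "verts D \<subseteq> {v. (u, v) \<in> (adj G)\<^sup>*}"
    using assms(2,3) adj_rtrancl_mono[OF D(3)] by (auto simp: graph_connected_adj)
  moreover have "e \<subseteq> verts D" if "e \<in> edges D" for e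
    using that D(1) by (simp add: simple_graph_def)
  ultimately show ?thesis
    using D unfolding subgraph_def component_of_def by auto
qed

lemma subgraph_antisym: "subgraph A B \<Longrightarrow> subgraph B A \<Longrightarrow> A = B"
  by (cases A; cases B) (auto simp: subgraph_def)

lemma component_component_of:
  assumes "simple_graph G" "u \<in> verts G"
  shows "component (component_of G u) G"
  unfolding component_def
proof (intro conjI allI impI)
  show "subgraph (component_of G u) G"
    using assms(1) by (rule subgraph_component_of)
  show "graph_connected (component_of G u)"
    using assms(2) by (rule graph_connected_component_of)
  fix D
  assume D: "subgraph D G \<and> graph_connected D \<and> subgraph (component_of G u) D"
  have "u \<in> verts (component_of G u)"
    using assms(2) by (simp add: component_of_def)
  then have "u \<in> verts D"
    using D by (auto simp: subgraph_def)
  then show "D = component_of G u"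
    using D by (metis connected_subgraph_component_of subgraph_antisym)
qed

text \<open>By connectedness \<open>C\<close> is contained in the reachability class of
  \<open>u\<close>; the maximality of \<open>C\<close> then forces equality.\<close>

lemma component_eq_component_of:
  assumes "simple_graph G" "component C G" "u \<in> verts C"
  shows "C = component_of G u"
proof -
  have C: "subgraph C G" "graph_connected C"
    using assms(2) by (auto simp: component_def)
  then have "u \<in> verts G"
    using assms(3) by (auto simp: subgraph_def)
  then show ?thesis
    using assms C connected_subgraph_component_of[OF C assms(3)]
      subgraph_component_of graph_connected_component_of
    unfolding component_def by metis
qed

lemma component_of_cong:
  assumes "(u, v) \<in> adj G"
  shows "component_of G u = component_of G v"
proof -
  have "(v, u) \<in> adj G"
    using assms sym_adj by (meson symE)
  then have "{w. (u, w) \<in> (adj G)\<^sup>*} = {w. (v, w) \<in> (adj G)\<^sup>*}"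
    using assms by (auto intro: converse_rtrancl_into_rtrancl)
  then show ?thesis
    by (simp add: component_of_def)
qed

section \<open>Decompositions with labelled remainder\<close>

text \<open>The components of \<open>G - U\<close> are encoded by a labelling \<open>f\<close> of the vertices outside \<open>U\<close>
  that is constant along edges; \<open>f u\<close> is an index of a bag containing the attachments of the
  component of \<open>u\<close>.\<close>

definition framing ::
  "'a ugraph \<Rightarrow> 'a set \<Rightarrow> 'b set \<Rightarrow> ('b \<Rightarrow> 'a set) \<Rightarrow> ('a \<Rightarrow> 'b) \<Rightarrow> bool" where
  "framing G U I W f \<longleftrightarrow>
     U \<subseteq> verts G \<and> (\<forall>i\<in>I. W i \<subseteq> U) \<and>
     (\<forall>e\<in>edges G. e \<subseteq> U \<longrightarrow> (\<exists>i\<in>I. e \<subseteq> W i)) \<and>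
     (\<forall>u\<in>verts G - U. f u \<in> I) \<and>
     (\<forall>u v. {u, v} \<in> edges G \<longrightarrow> u \<notin> U \<longrightarrow> (if v \<in> U then v \<in> W (f u) else f v = f u))"

lemma framingD:
  assumes "framing G U I W f"
  shows "U \<subseteq> verts G" "\<And>i. i \<in> I \<Longrightarrow> W i \<subseteq> U"
    "\<And>e. e \<in> edges G \<Longrightarrow> e \<subseteq> U \<Longrightarrow> \<exists>i\<in>I. e \<subseteq> W i"
    "\<And>u. u \<in> verts G \<Longrightarrow> u \<notin> U \<Longrightarrow> f u \<in> I"
    "\<And>u v. {u, v} \<in> edges G \<Longrightarrow> u \<notin> U \<Longrightarrow> v \<in> U \<Longrightarrow> v \<in> W (f u)"
    "\<And>u v. {u, v} \<in> edges G \<Longrightarrow> u \<notin> U \<Longrightarrow> v \<notin> U \<Longrightarrow> f v = f u"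
  using assms unfolding framing_def by (auto split: if_splits)

lemma rooted_tree_decomposition_framing:
  assumes G: "simple_graph G" and dec: "rooted_tree_decomposition G S T W"
  obtains U f where "framing G U (verts T) W f" "S \<subseteq> U" "is_tree T"
    "\<And>v. v \<in> U \<Longrightarrow> is_tree (induced T {x \<in> verts T. v \<in> W x})"
proof -
  obtain H where H: "induced_subgraph H G" "S \<subseteq> verts H" "tree_decomposition H T W"
    and nb: "\<And>C. component C (delete_verts G (verts H)) \<Longrightarrow>
      \<exists>x\<in>verts T. neighbours G (verts C) \<subseteq> W x"
    using dec unfolding rooted_tree_decomposition_def by blast
  let ?D = "delete_verts G (verts H)"
  have HG: "verts H \<subseteq> verts G"
    using H(1) by (auto simp: induced_subgraph_def)
  then have He: "edges H = {e \<in> edges G. e \<subseteq> verts H}"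
    using H(1) G by (auto simp: induced_subgraph_def simple_graph_def Int_absorb1)
  \<comment> \<open>The choice depends on \<open>u\<close> only through its component. This makes
    \<open>f\<close> constant along edges outside \<open>H\<close>.\<close>
  define f where
    "f u = (SOME x. x \<in> verts T \<and> neighbours G (verts (component_of ?D u)) \<subseteq> W x)" for u
  have f: "f u \<in> verts T" "neighbours G (verts (component_of ?D u)) \<subseteq> W (f u)"
    if "u \<in> verts G" "u \<notin> verts H" for u
  proof -
    have "component (component_of ?D u) ?D"
      using that G by (auto intro: component_component_of simple_graph_delete_verts)
    then have "\<exists>x. x \<in> verts T \<and> neighbours G (verts (component_of ?D u)) \<subseteq> W x"
      using nb by blast
    then have "f u \<in> verts T \<and> neighbours G (verts (component_of ?D u)) \<subseteq> W (f u)"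
      unfolding f_def by (rule someI_ex)
    then show "f u \<in> verts T" "neighbours G (verts (component_of ?D u)) \<subseteq> W (f u)"
      by auto
  qed
  have "framing G (verts H) (verts T) W f"
    unfolding framing_def
  proof (intro conjI allI impI ballI)
    fix u v
    assume uv: "{u, v} \<in> edges G" and u: "u \<notin> verts H"
    have V: "u \<in> verts G" "v \<in> verts G"
      using simple_graph_edgeD[OF G uv] by auto
    show "if v \<in> verts H then v \<in> W (f u) else f v = f u"
    proof (cases "v \<in> verts H")
      case True
      have "v \<in> neighbours G (verts (component_of ?D u))"
        using True u uv V by (auto simp: neighbours_def component_of_def)
      then show ?thesis
        using True f(2)[OF V(1) u] by auto
    next
      case False
      then have "(u, v) \<in> adj ?D"
        using u uv V by (auto simp: adj_def)
      then show ?thesis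
        using False component_of_cong[of u v ?D] by (simp add: f_def)
    qed
  qed (use HG H(3) He f(1) in \<open>auto simp: tree_decomposition_def\<close>)
  then show ?thesis
    using that H by (auto simp: tree_decomposition_def)
qed

text \<open>All vertices of a component of \<open>G - U\<close> carry the same label, and the bag
  with this label contains every neighbour of the component.\<close>

lemma framing_rooted_tree_decomposition:
  assumes G: "simple_graph G" and fr: "framing G U (verts T) W f" and "S \<subseteq> U" "is_tree T"
    and sub: "\<And>v. v \<in> U \<Longrightarrow> is_tree (induced T {x \<in> verts T. v \<in> W x})"
  shows "rooted_tree_decomposition G S T W"
proof -
  note F = framingD[OF fr]
  let ?H = "induced G U"
  have VH: "verts ?H = U"
    using F(1) by auto
  have "\<exists>x\<in>verts T. neighbours G (verts C) \<subseteq> W x" if C: "component C (delete_verts G U)" for C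
  proof -
    let ?D = "delete_verts G U"
    have D: "simple_graph ?D"
      using G by (rule simple_graph_delete_verts)
    obtain u where u: "u \<in> verts C"
      using C by (auto simp: component_def graph_connected_def)
    then have uD: "u \<in> verts ?D"
      using C by (auto simp: component_def subgraph_def)
    have CD: "C = component_of ?D u"
      using D C u by (rule component_eq_component_of)
    have const: "f w = f u" if "(u, w) \<in> (adj ?D)\<^sup>*" for w
      using that
    proof (induction rule: rtrancl_induct)
      case (step y z)
      then have "{y, z} \<in> edges G" "y \<notin> U" "z \<notin> U"
        by (auto simp: adj_def)
      then show ?case
        using F(6) step.IH by auto
    qed simp
    have "neighbours G (verts C) \<subseteq> W (f u)"
    proof
      fix v
      assume "v \<in> neighbours G (verts C)"
      then obtain w where v: "v \<in> verts G" "v \<notin> verts C" and w: "w \<in> verts C" "{w, v} \<in> edges G"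
        by (auto simp: neighbours_def)
      have wD: "(u, w) \<in> (adj ?D)\<^sup>*" "w \<in> verts G" "w \<notin> U"
        using w(1) by (auto simp: CD component_of_def)
      \<comment> \<open>A neighbour outside \<open>U\<close> could be reached from \<open>u\<close>
        and would belong to the component itself.\<close>
      have "v \<in> U"
      proof (rule ccontr)
        assume "v \<notin> U"
        then have "(w, v) \<in> adj ?D"
          using w v wD by (auto simp: adj_def)
        then have "(u, v) \<in> (adj ?D)\<^sup>*"
          using wD by (meson rtrancl_into_rtrancl)
        then show False
          using v \<open>v \<notin> U\<close> by (auto simp: CD component_of_def)
      qed
      then show "v \<in> W (f u)"
        using F(5)[OF w(2) wD(3)] const[OF wD(1)] by auto
    qed
    moreover have "f u \<in> verts T"
      using F(4) uD by auto
    ultimately show ?thesis by blast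
  qed
  moreover have "tree_decomposition ?H T W"
    unfolding tree_decomposition_def VH using assms F by auto
  moreover have "induced_subgraph ?H G"
    using F(1) by (auto simp: induced_subgraph_def)
  ultimately show ?thesis
    unfolding rooted_tree_decomposition_def using VH assms(3) by metis
qed

section \<open>Trees given by parent functions\<close>

text \<open>Trees on natural numbers are rooted at 0, with parents smaller than their children. The
  numerical order replaces arguments about paths: climbing to the root terminates, and the largest
  node of a putative cycle yields a contradiction.\<close>

definition parent_tree :: "nat set \<Rightarrow> (nat \<Rightarrow> nat) \<Rightarrow> bool" where
  "parent_tree N p \<longleftrightarrow> finite N \<and> 0 \<in> N \<and> (\<forall>i\<in>N. i \<noteq> 0 \<longrightarrow> p i \<in> N \<and> p i < i)"

definition parent_graph :: "nat set \<Rightarrow> (nat \<Rightarrow> nat) \<Rightarrow> nat ugraph" where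
  "parent_graph N p = \<lparr>verts = N, edges = {{i, p i} | i. i \<in> N \<and> i \<noteq> 0}\<rparr>"

text \<open>The witness \<open>t\<close> is the top node of the subtree. Any other member must
  differ from 0 because \<open>p 0\<close> is unconstrained; so a subtree containing 0 has 0 as its
  top.\<close>

definition parent_subtree :: "(nat \<Rightarrow> nat) \<Rightarrow> nat set \<Rightarrow> bool" where
  "parent_subtree p X \<longleftrightarrow> (\<exists>t\<in>X. \<forall>i\<in>X. i \<noteq> t \<longrightarrow> i \<noteq> 0 \<and> p i \<in> X)"

lemma parent_subtree_root: "parent_subtree p X \<Longrightarrow> 0 \<in> X \<Longrightarrow> i \<in> X \<Longrightarrow> i \<noteq> 0 \<Longrightarrow> p i \<in> X"
  unfolding parent_subtree_def by metis

text \<open>The cyclic successor and predecessor of \<open>x\<close> are distinct since a cycle has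
  at least three vertices.\<close>

lemma is_cycle_two_neighbours:
  assumes "is_cycle T vs" "x \<in> set vs"
  obtains y z where "y \<in> set vs" "z \<in> set vs" "y \<noteq> z" "{x, y} \<in> edges T" "{x, z} \<in> edges T"
proof -
  let ?n = "length vs"
  have n: "3 \<le> ?n" and d: "distinct vs"
    and e: "\<And>i. i < ?n \<Longrightarrow> {vs ! i, vs ! (Suc i mod ?n)} \<in> edges T"
    using assms(1) by (auto simp: is_cycle_def)
  obtain i where i: "i < ?n" "vs ! i = x"
    using assms(2) by (auto simp: in_set_conv_nth)
  define j where "j = (if i = 0 then ?n - 1 else i - 1)"
  have j: "j < ?n" "Suc j mod ?n = i"
    using i n by (auto simp: j_def)
  have k: "Suc i mod ?n < ?n"
    using n by (intro mod_less_divisor) linarith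
  have ne: "Suc i mod ?n \<noteq> j"
  proof (cases "Suc i = ?n")
    case True
    then show ?thesis using n by (auto simp: j_def)
  next
    case False
    then show ?thesis using i n by (auto simp: j_def)
  qed
  show ?thesis
  proof (rule that)
    show "vs ! (Suc i mod ?n) \<in> set vs" "vs ! j \<in> set vs"
      using j k by auto
    show "vs ! (Suc i mod ?n) \<noteq> vs ! j"
      using ne d j k by (simp add: nth_eq_iff_index_eq)
    show "{x, vs ! (Suc i mod ?n)} \<in> edges T"
      using e[OF i(1)] i(2) by simp
    show "{x, vs ! j} \<in> edges T"
      using e[OF j(1)] j(2) i(2) by (simp add: insert_commute)
  qed
qed

text \<open>Climbing along parents connects each node of \<open>X\<close> to the top node. There is
  no cycle, since its largest node would have only its parent as a neighbour on it.\<close>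

lemma is_tree_parent_subtree:
  assumes N: "parent_tree N p" and XN: "X \<subseteq> N" and sub: "parent_subtree p X"
  shows "is_tree (induced (parent_graph N p) X)"
proof -
  let ?T = "induced (parent_graph N p) X"
  have p: "p i \<in> N" "p i < i" if "i \<in> N" "i \<noteq> 0" for i
    using that N by (auto simp: parent_tree_def)
  have V: "verts ?T = X"
    using XN by (auto simp: parent_graph_def)
  have E: "edges ?T = {e. e \<subseteq> X \<and> (\<exists>i. i \<in> N \<and> i \<noteq> 0 \<and> e = {i, p i})}"
    by (auto simp: parent_graph_def)
  obtain t where t: "t \<in> X" "\<And>i. i \<in> X \<Longrightarrow> i \<noteq> t \<Longrightarrow> i \<noteq> 0 \<and> p i \<in> X"
    using sub by (auto simp: parent_subtree_def)
  have "finite X"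
    using N XN finite_subset by (auto simp: parent_tree_def)
  moreover have "card {i, p i} = 2" if "i \<in> N" "i \<noteq> 0" for i
    using p[OF that] by simp
  ultimately have simple: "simple_graph ?T"
    unfolding simple_graph_def V E by auto
  have up: "(i, t) \<in> (adj ?T)\<^sup>*" if "i \<in> X" for i
    using that
  proof (induction i rule: less_induct)
    case (less i)
    show ?case
    proof (cases "i = t")
      case False
      then have i: "i \<noteq> 0" "p i \<in> X" "i \<in> N"
        using t less.prems XN by auto
      then have "(i, p i) \<in> adj ?T"
        using less.prems unfolding adj_def E by auto
      then show ?thesis
        using less.IH[of "p i"] p i by (meson converse_rtrancl_into_rtrancl)
    qed simp
  qed
  have "graph_connected ?T"
    unfolding graph_connected_adj V using t(1) up
    by (meson adj_rtrancl_sym empty_iff rtrancl_trans)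
  moreover have "\<not> is_cycle ?T vs" for vs
  proof
    assume c: "is_cycle ?T vs"
    then have ne: "set vs \<noteq> {}"
      by (auto simp: is_cycle_def)
    let ?m = "Max (set vs)"
    have m: "?m \<in> set vs"
      using ne by simp
    \<comment> \<open>An edge joins a node to its smaller parent, and \<open>y\<close> does not
      exceed the maximum, so the maximum is the child.\<close>
    have par: "y = p ?m" if y: "y \<in> set vs" "{?m, y} \<in> edges ?T" for y
    proof -
      have "y \<le> ?m"
        using y by simp
      moreover obtain i where "i \<in> N" "i \<noteq> 0" "{?m, y} = {i, p i}"
        using y(2) unfolding E by blast
      ultimately show ?thesis
        using p[of i] by (auto simp: doubleton_eq_iff)
    qed
    show False
      using is_cycle_two_neighbours[OF c m] par by metis
  qed
  ultimately show ?thesis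
    using simple by (auto simp: is_tree_def)
qed

lemma is_tree_parent_graph:
  assumes "parent_tree N p"
  shows "is_tree (parent_graph N p)"
proof -
  have p: "0 \<in> N" "\<And>i. i \<in> N \<Longrightarrow> i \<noteq> 0 \<Longrightarrow> p i \<in> N"
    using assms by (auto simp: parent_tree_def)
  then have "parent_subtree p N"
    unfolding parent_subtree_def by (intro bexI[of _ 0]) simp_all
  then have "is_tree (induced (parent_graph N p) N)"
    using assms by (intro is_tree_parent_subtree) auto
  moreover have "induced (parent_graph N p) N = parent_graph N p"
    using p by (auto simp: induced_def parent_graph_def)
  ultimately show ?thesis by simp
qed

section \<open>Gluing decompositions\<close>

text \<open>Node 0 is the root, and prescribing \<open>Z\<close> inside its bag is the strengthening
  that makes induction possible: two layouts are glued along what their root bags are known to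
  contain.\<close>

definition layout :: "'a ugraph \<Rightarrow> 'a set \<Rightarrow> 'a set \<Rightarrow> nat \<Rightarrow> bool" where
  "layout G S Z b \<longleftrightarrow> (\<exists>U N p W f.
     framing G U N W f \<and> parent_tree N p \<and> S \<subseteq> U \<and> Z \<subseteq> W 0 \<and>
     (\<forall>i\<in>N. card (W i) \<le> b) \<and> (\<forall>v\<in>U. parent_subtree p {i \<in> N. v \<in> W i}))"

lemma layout_mono: "layout G S Z b \<Longrightarrow> Z' \<subseteq> Z \<Longrightarrow> layout G S Z' b"
  unfolding layout_def by (meson subset_trans)

text \<open>Since \<open>S\<close> lies in the only bag, everything outside \<open>Z\<close> may
  stay undecomposed and be attached to that bag.\<close>

lemma layout_single:
  assumes "simple_graph G" "S \<subseteq> Z" "Z \<subseteq> verts G" "card Z \<le> b"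
  shows "layout G S Z b"
proof -
  have "framing G Z {0::nat} (\<lambda>_. Z) (\<lambda>_. 0)"
    using assms(3) by (auto simp: framing_def)
  moreover have "parent_tree {0} (\<lambda>_. 0)"
    by (simp add: parent_tree_def)
  moreover have "parent_subtree (\<lambda>_. 0) {i \<in> {0::nat}. v \<in> Z}" if "v \<in> Z" for v
    using that by (simp add: parent_subtree_def)
  ultimately show ?thesis
    unfolding layout_def using assms
    by (intro exI[of _ Z] exI[of _ "{0}"] exI[of _ "\<lambda>_. 0"] exI[of _ "\<lambda>_. Z"] exI[of _ "\<lambda>_. 0"])
      simp
qed

text \<open>The new root bag \<open>Y\<close> contains the separator, and each side has its share of
  \<open>Y\<close> in its own root bag. Hanging both old roots below the new one therefore keeps the
  nodes of each vertex connected.\<close>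

lemma layout_glue:
  assumes G: "simple_graph G" and AB: "A \<union> B = verts G"
    and E: "\<And>e. e \<in> edges G \<Longrightarrow> e \<subseteq> A \<or> e \<subseteq> B"
    and Y: "A \<inter> B \<subseteq> Y" "Y \<subseteq> verts G" "card Y \<le> b" and S: "S \<subseteq> verts G"
    and lA: "layout (induced G A) (S \<inter> A) (Y \<inter> A) b"
    and lB: "layout (induced G B) (S \<inter> B) (Y \<inter> B) b"
  shows "layout G S Y b"
proof -
  obtain U\<^sub>1 N\<^sub>1 p\<^sub>1 W\<^sub>1 f\<^sub>1 where fr1: "framing (induced G A) U\<^sub>1 N\<^sub>1 W\<^sub>1 f\<^sub>1"
    and l1: "parent_tree N\<^sub>1 p\<^sub>1" "S \<inter> A \<subseteq> U\<^sub>1" "Y \<inter> A \<subseteq> W\<^sub>1 0"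
      "\<And>i. i \<in> N\<^sub>1 \<Longrightarrow> card (W\<^sub>1 i) \<le> b"
      "\<And>v. v \<in> U\<^sub>1 \<Longrightarrow> parent_subtree p\<^sub>1 {i \<in> N\<^sub>1. v \<in> W\<^sub>1 i}"
    using lA unfolding layout_def by blast
  obtain U\<^sub>2 N\<^sub>2 p\<^sub>2 W\<^sub>2 f\<^sub>2 where fr2: "framing (induced G B) U\<^sub>2 N\<^sub>2 W\<^sub>2 f\<^sub>2"
    and l2: "parent_tree N\<^sub>2 p\<^sub>2" "S \<inter> B \<subseteq> U\<^sub>2" "Y \<inter> B \<subseteq> W\<^sub>2 0"
      "\<And>i. i \<in> N\<^sub>2 \<Longrightarrow> card (W\<^sub>2 i) \<le> b"
      "\<And>v. v \<in> U\<^sub>2 \<Longrightarrow> parent_subtree p\<^sub>2 {i \<in> N\<^sub>2. v \<in> W\<^sub>2 i}"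
    using lB unfolding layout_def by blast
  note F1 = framingD[OF fr1] and F2 = framingD[OF fr2]
  have N1: "finite N\<^sub>1" "0 \<in> N\<^sub>1" "\<And>i. i \<in> N\<^sub>1 \<Longrightarrow> i \<noteq> 0 \<Longrightarrow> p\<^sub>1 i \<in> N\<^sub>1 \<and> p\<^sub>1 i < i"
    and N2: "finite N\<^sub>2" "0 \<in> N\<^sub>2" "\<And>i. i \<in> N\<^sub>2 \<Longrightarrow> i \<noteq> 0 \<Longrightarrow> p\<^sub>2 i \<in> N\<^sub>2 \<and> p\<^sub>2 i < i"
    using l1(1) l2(1) by (auto simp: parent_tree_def)
  have UA: "U\<^sub>1 \<subseteq> A" "Y \<inter> A \<subseteq> U\<^sub>1" and UB: "U\<^sub>2 \<subseteq> B" "Y \<inter> B \<subseteq> U\<^sub>2"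
    using F1(1) F2(1) F1(2)[OF N1(2)] F2(2)[OF N2(2)] l1(3) l2(3) by auto
  define U where "U = U\<^sub>1 \<union> U\<^sub>2"
  \<comment> \<open>A vertex of \<open>A\<close> coming from \<open>U\<^sub>2\<close> lies in
    \<open>A \<inter> B\<close>, hence in \<open>Y \<inter> A\<close>, which is part of
    \<open>U\<^sub>1\<close>.\<close>
  have UA': "v \<in> U\<^sub>1" if "v \<in> U" "v \<in> A" for v
    using that UA UB Y by (auto simp: U_def)
  have UB': "v \<in> U\<^sub>2" if "v \<in> U" "v \<in> B" for v
    using that UA UB Y by (auto simp: U_def)
  have YU: "Y \<subseteq> U"
    using Y(2) AB UA(2) UB(2) by (auto simp: U_def)
  \<comment> \<open>Node \<open>i\<close> becomes \<open>2 i + 1\<close> in the first tree and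
    \<open>2 i + 2\<close> in the second. This frees 0 for the new root and preserves the order
    within each tree.\<close>
  let ?a = "\<lambda>i::nat. Suc (2 * i)" and ?b = "\<lambda>i::nat. Suc (Suc (2 * i))"
  define N where "N = insert 0 (?a ` N\<^sub>1 \<union> ?b ` N\<^sub>2)"
  define W where
    "W n = (if n = 0 then Y else if odd n then W\<^sub>1 (n div 2) else W\<^sub>2 (n div 2 - 1))" for n
  \<comment> \<open>The old roots are now the nodes 1 and 2, and their parent is the new root
    0.\<close>
  define p where
    "p n = (if n \<le> 2 then 0 else if odd n then ?a (p\<^sub>1 (n div 2)) else ?b (p\<^sub>2 (n div 2 - 1)))" for n
  \<comment> \<open>Outside \<open>U\<close> the two cases do not conflict, because
    \<open>A \<inter> B\<close> lies in \<open>Y\<close> and so in \<open>U\<close>.\<close>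
  define f where "f v = (if v \<in> A then ?a (f\<^sub>1 v) else ?b (f\<^sub>2 v))" for v
  have W: "W 0 = Y" "\<And>i. W (?a i) = W\<^sub>1 i" "\<And>i. W (?b i) = W\<^sub>2 i"
    by (simp_all add: W_def)
  have p: "p (?a 0) = 0" "p (?b 0) = 0" "\<And>i. i \<noteq> 0 \<Longrightarrow> p (?a i) = ?a (p\<^sub>1 i)"
    "\<And>i. i \<noteq> 0 \<Longrightarrow> p (?b i) = ?b (p\<^sub>2 i)"
    by (simp_all add: p_def)
  have N_cases: "(n = 0 \<Longrightarrow> P) \<Longrightarrow> (\<And>i. i \<in> N\<^sub>1 \<Longrightarrow> n = ?a i \<Longrightarrow> P) \<Longrightarrow>
      (\<And>i. i \<in> N\<^sub>2 \<Longrightarrow> n = ?b i \<Longrightarrow> P) \<Longrightarrow> P" if "n \<in> N" for n P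
    using that unfolding N_def by blast
  have N: "0 \<in> N" "\<And>i. i \<in> N\<^sub>1 \<Longrightarrow> ?a i \<in> N" "\<And>i. i \<in> N\<^sub>2 \<Longrightarrow> ?b i \<in> N"
    by (auto simp: N_def)
  have "parent_tree N p"
    unfolding parent_tree_def
  proof (intro conjI ballI impI)
    show "finite N" "0 \<in> N"
      using N1 N2 by (auto simp: N_def)
    fix n
    assume n: "n \<in> N" "n \<noteq> 0"
    have "p n \<in> N \<and> p n < n"
      using n(1)
    proof (rule N_cases)
      fix i
      assume i: "i \<in> N\<^sub>1" "n = ?a i"
      show ?thesis
      proof (cases "i = 0")
        case False
        then show ?thesis using i N1(3)[OF i(1)] N(2) p(3) by auto
      qed (use i p N in auto)
    next
      fix i
      assume i: "i \<in> N\<^sub>2" "n = ?b i"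
      show ?thesis
      proof (cases "i = 0")
        case False
        then show ?thesis using i N2(3)[OF i(1)] N(3) p(4) by auto
      qed (use i p N in auto)
    qed (use n in auto)
    then show "p n \<in> N" "p n < n" by auto
  qed
  moreover have "framing G U N W f"
    unfolding framing_def
  proof (intro conjI ballI impI allI)
    show "U \<subseteq> verts G"
      using UA UB AB by (auto simp: U_def)
    show "W n \<subseteq> U" if "n \<in> N" for n
      using that
    proof (rule N_cases)
      show "W n \<subseteq> U" if "i \<in> N\<^sub>1" "n = ?a i" for i
        unfolding that(2) W U_def using F1(2)[OF that(1)] by auto
      show "W n \<subseteq> U" if "i \<in> N\<^sub>2" "n = ?b i" for i
        unfolding that(2) W U_def using F2(2)[OF that(1)] by auto
    qed (use W(1) YU in simp)
    show "\<exists>n\<in>N. e \<subseteq> W n" if e: "e \<in> edges G" "e \<subseteq> U" for e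
    proof (cases "e \<subseteq> A")
      case True
      then have "e \<subseteq> U\<^sub>1"
        using e(2) UA' by auto
      then obtain i where "i \<in> N\<^sub>1" "e \<subseteq> W\<^sub>1 i"
        using F1(3)[of e] True e by auto
      then show ?thesis
        using N(2) W(2) by metis
    next
      case False
      then have "e \<subseteq> B"
        using E[OF e(1)] by auto
      moreover from this have "e \<subseteq> U\<^sub>2"
        using e(2) UB' by auto
      ultimately obtain i where "i \<in> N\<^sub>2" "e \<subseteq> W\<^sub>2 i"
        using F2(3)[of e] e by auto
      then show ?thesis
        using N(3) W(3) by metis
    qed
    show "f u \<in> N" if "u \<in> verts G - U" for u
    proof (cases "u \<in> A")
      case True
      then have "f\<^sub>1 u \<in> N\<^sub>1"
        using that by (intro F1(4)) (auto simp: U_def)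
      then show ?thesis
        using True N by (simp add: f_def)
    next
      case False
      then have "f\<^sub>2 u \<in> N\<^sub>2"
        using that AB by (intro F2(4)) (auto simp: U_def)
      then show ?thesis
        using False N by (simp add: f_def)
    qed
    show "if v \<in> U then v \<in> W (f u) else f v = f u" if uv: "{u, v} \<in> edges G" "u \<notin> U" for u v
    proof (cases "u \<in> A")
      case True
      \<comment> \<open>As \<open>u\<close> is not in the separator, the edge must lie entirely in
        \<open>A\<close>, and the framing of that side applies.\<close>
      then have "u \<notin> B"
        using uv(2) Y UA YU by auto
      then have v: "v \<in> A"
        using E[OF uv(1)] by auto
      then have e: "{u, v} \<in> edges (induced G A)"
        using uv True by simp
      have u: "u \<notin> U\<^sub>1"
        using uv(2) by (simp add: U_def)
      show ?thesis
      proof (cases "v \<in> U")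
        case True
        then have "v \<in> W\<^sub>1 (f\<^sub>1 u)"
          using F1(5)[OF e u] UA' v by auto
        then show ?thesis
          using True \<open>u \<in> A\<close> by (simp add: f_def W)
      next
        case False
        then have "f\<^sub>1 v = f\<^sub>1 u"
          using F1(6)[OF e u] by (simp add: U_def)
        then show ?thesis
          using False \<open>u \<in> A\<close> v by (simp add: f_def)
      qed
    next
      case False
      then have uB: "u \<in> B"
        using simple_graph_edgeD[OF G uv(1)] AB by auto
      then have v: "v \<in> B"
        using E[OF uv(1)] False by auto
      then have e: "{u, v} \<in> edges (induced G B)"
        using uv uB by simp
      have u: "u \<notin> U\<^sub>2"
        using uv(2) by (simp add: U_def)
      show ?thesis
      proof (cases "v \<in> U")
        case True
        then have "v \<in> W\<^sub>2 (f\<^sub>2 u)"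
          using F2(5)[OF e u] UB' v by auto
        then show ?thesis
          using True False by (simp add: f_def W)
      next
        case notin: False
        then have "v \<notin> A"
          using v Y YU by auto
        moreover have "f\<^sub>2 v = f\<^sub>2 u"
          using F2(6)[OF e u] notin by (simp add: U_def)
        ultimately show ?thesis
          using False notin by (simp add: f_def)
      qed
    qed
  qed
  moreover have "S \<subseteq> U"
    using S AB l1(2) l2(2) by (auto simp: U_def)
  moreover have "card (W n) \<le> b" if "n \<in> N" for n
    using that
  proof (rule N_cases)
  qed (use W Y(3) l1(4) l2(4) in auto)
  \<comment> \<open>For \<open>v\<close> in \<open>Y\<close> the top node is the new root: on each
    side the old subtree of \<open>v\<close>, if there is one, reaches the old root. For
    \<open>v\<close> outside \<open>Y\<close> only one side contains \<open>v\<close>, and the old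
    top node is kept.\<close>
  moreover have "parent_subtree p {n \<in> N. v \<in> W n}" if v: "v \<in> U" for v
  proof (cases "v \<in> Y")
    case True
    have root1: "p\<^sub>1 i \<in> N\<^sub>1 \<and> v \<in> W\<^sub>1 (p\<^sub>1 i)" if i: "i \<in> N\<^sub>1" "v \<in> W\<^sub>1 i" "i \<noteq> 0" for i
    proof -
      have v1: "v \<in> U\<^sub>1"
        using F1(2) i by auto
      then have "v \<in> W\<^sub>1 0"
        using True UA l1(3) by auto
      then show ?thesis
        using parent_subtree_root[OF l1(5)[OF v1]] i N1(2) by auto
    qed
    have root2: "p\<^sub>2 i \<in> N\<^sub>2 \<and> v \<in> W\<^sub>2 (p\<^sub>2 i)" if i: "i \<in> N\<^sub>2" "v \<in> W\<^sub>2 i" "i \<noteq> 0" for i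
    proof -
      have v2: "v \<in> U\<^sub>2"
        using F2(2) i by auto
      then have "v \<in> W\<^sub>2 0"
        using True UB l2(3) by auto
      then show ?thesis
        using parent_subtree_root[OF l2(5)[OF v2]] i N2(2) by auto
    qed
    have "p n \<in> N \<and> v \<in> W (p n)" if n: "n \<in> N" "v \<in> W n" "n \<noteq> 0" for n
      using n(1)
    proof (rule N_cases)
      fix i
      assume i: "i \<in> N\<^sub>1" "n = ?a i"
      show ?thesis
      proof (cases "i = 0")
        case False
        then show ?thesis using i n root1[of i] N(2) p(3) W(2) by auto
      qed (use i p N W True in auto)
    next
      fix i
      assume i: "i \<in> N\<^sub>2" "n = ?b i"
      show ?thesis
      proof (cases "i = 0")
        case False
        then show ?thesis using i n root2[of i] N(3) p(4) W(3) by auto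
      qed (use i p N W True in auto)
    qed (use n in auto)
    then show ?thesis
      unfolding parent_subtree_def using True N(1) W(1) by (intro bexI[of _ 0]) auto
  next
    case False
    show ?thesis
    proof (cases "v \<in> A")
      case True
      then have "v \<notin> B"
        using False Y by auto
      then have "v \<notin> U\<^sub>2" "v \<in> U\<^sub>1"
        using UB v by (auto simp: U_def)
      then obtain t where t: "t \<in> N\<^sub>1" "v \<in> W\<^sub>1 t"
        "\<And>i. i \<in> N\<^sub>1 \<Longrightarrow> v \<in> W\<^sub>1 i \<Longrightarrow> i \<noteq> t \<Longrightarrow> i \<noteq> 0 \<and> p\<^sub>1 i \<in> N\<^sub>1 \<and> v \<in> W\<^sub>1 (p\<^sub>1 i)"
        using l1(5) unfolding parent_subtree_def by blast
      have "n \<noteq> 0 \<and> p n \<in> N \<and> v \<in> W (p n)" if n: "n \<in> N" "v \<in> W n" "n \<noteq> ?a t" for n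
        using n(1)
      proof (rule N_cases)
        fix i
        assume i: "i \<in> N\<^sub>1" "n = ?a i"
        then show ?thesis
          using t(3)[of i] n N(2) p(3) W(2) by auto
      next
        fix i
        assume i: "i \<in> N\<^sub>2" "n = ?b i"
        then show ?thesis
          using n W(3) F2(2) \<open>v \<notin> U\<^sub>2\<close> by auto
      qed (use n W False in auto)
      then show ?thesis
        unfolding parent_subtree_def using t N(2) W(2) by (intro bexI[of _ "?a t"]) auto
    next
      case nA: False
      then have "v \<notin> U\<^sub>1" "v \<in> U\<^sub>2"
        using UA v by (auto simp: U_def)
      then obtain t where t: "t \<in> N\<^sub>2" "v \<in> W\<^sub>2 t"
        "\<And>i. i \<in> N\<^sub>2 \<Longrightarrow> v \<in> W\<^sub>2 i \<Longrightarrow> i \<noteq> t \<Longrightarrow> i \<noteq> 0 \<and> p\<^sub>2 i \<in> N\<^sub>2 \<and> v \<in> W\<^sub>2 (p\<^sub>2 i)"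
        using l2(5) unfolding parent_subtree_def by blast
      have "n \<noteq> 0 \<and> p n \<in> N \<and> v \<in> W (p n)" if n: "n \<in> N" "v \<in> W n" "n \<noteq> ?b t" for n
        using n(1)
      proof (rule N_cases)
        fix i
        assume i: "i \<in> N\<^sub>2" "n = ?b i"
        then show ?thesis
          using t(3)[of i] n N(3) p(4) W(3) by auto
      next
        fix i
        assume i: "i \<in> N\<^sub>1" "n = ?a i"
        then show ?thesis
          using n W(2) F1(2) \<open>v \<notin> U\<^sub>1\<close> by auto
      qed (use n W False in auto)
      then show ?thesis
        unfolding parent_subtree_def using t N(3) W(3) by (intro bexI[of _ "?b t"]) auto
    qed
  qed
  ultimately show ?thesis
    unfolding layout_def using W(1) by blast
qed

section \<open>Bounding tree-width by layouts\<close>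

lemma finite_rooted_tree_decomposition_widths:
  assumes "simple_graph G"
  shows "finite {w. \<exists>(T :: nat ugraph) W. rooted_tree_decomposition G S T W \<and> w = width T W}"
    (is "finite ?X")
proof -
  have "?X \<subseteq> {-1..int (card (verts G)) - 1}"
    using rooted_tree_decomposition_width_bounds[OF assms] by fastforce
  then show ?thesis
    by (rule finite_subset) simp
qed

lemma layout_treewidth:
  assumes G: "simple_graph G" and lay: "layout G S Z b"
  shows "treewidth G S \<le> int b - 1"
proof -
  obtain U N p W f where fr: "framing G U N W f" and N: "parent_tree N p" and SU: "S \<subseteq> U"
    and b: "\<And>i. i \<in> N \<Longrightarrow> card (W i) \<le> b"
    and sub: "\<And>v. v \<in> U \<Longrightarrow> parent_subtree p {i \<in> N. v \<in> W i}"
    using lay unfolding layout_def by blast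
  let ?T = "parent_graph N p"
  have V: "verts ?T = N"
    by (simp add: parent_graph_def)
  have dec: "rooted_tree_decomposition G S ?T W"
    using G fr SU N sub
    by (intro framing_rooted_tree_decomposition)
      (auto simp: V intro!: is_tree_parent_graph is_tree_parent_subtree)
  have "treewidth G S \<le> width ?T W"
    unfolding treewidth_def using dec finite_rooted_tree_decomposition_widths[OF G]
    by (intro Min_le) auto
  moreover have "width ?T W \<le> int b - 1"
  proof -
    have "finite N" "N \<noteq> {}"
      using N by (auto simp: parent_tree_def)
    then have "Max ((\<lambda>i. int (card (W i))) ` N) \<le> int b"
      using b by simp
    then show ?thesis
      by (simp add: width_def V)
  qed
  ultimately show ?thesis by simp
qed

section \<open>Decomposing graphs without a large tangle\<close>

lemma separationD:
  assumes "separation G A B"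
  shows "simple_graph A" "simple_graph B" "verts A \<union> verts B = verts G"
    "edges A \<union> edges B = edges G" "edges A \<inter> edges B = {}"
    "\<And>e. e \<in> edges G \<Longrightarrow> e \<subseteq> verts A \<or> e \<subseteq> verts B"
proof -
  have sub: "subgraph A G" "subgraph B G" and un: "graph_union A B = G"
    and int: "edges (graph_inter A B) = {}"
    using assms by (auto simp: separation_def)
  show s: "simple_graph A" "simple_graph B"
    using sub by (auto simp: subgraph_def)
  show "verts A \<union> verts B = verts G" "edges A \<union> edges B = edges G"
    using arg_cong[OF un, of verts] arg_cong[OF un, of edges] by (simp_all add: graph_union_def)
  then show "\<And>e. e \<in> edges G \<Longrightarrow> e \<subseteq> verts A \<or> e \<subseteq> verts B"
    using s unfolding simple_graph_def by blast
  show "edges A \<inter> edges B = {}"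
    using int by (simp add: graph_inter_def)
qed

lemma separationI:
  assumes "simple_graph A" "simple_graph B" "verts A \<union> verts B = verts G"
    "edges A \<union> edges B = edges G" "edges A \<inter> edges B = {}"
  shows "separation G A B"
proof -
  have "graph_union A B = G"
    using assms(3,4) by (cases G) (simp add: graph_union_def)
  moreover have "subgraph A G" "subgraph B G"
    using assms by (auto simp: subgraph_def)
  ultimately show ?thesis
    using assms(5) by (simp add: separation_def graph_inter_def)
qed

lemma separation_commute:
  assumes "separation G A B"
  shows "separation G B A"
  using separationD[OF assms] by (intro separationI) auto

lemma sep_order_commute: "sep_order A B = sep_order B A"
  by (simp add: sep_order_def Int_commute)

lemma tangleD:
  assumes "tangle G k \<T>"
  shows "1 \<le> k"
    "\<And>A B. (A, B) \<in> \<T> \<Longrightarrow> separation G A B"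
    "\<And>A B. (A, B) \<in> \<T> \<Longrightarrow> sep_order A B < k"
    "\<And>A B. separation G A B \<Longrightarrow> sep_order A B < k \<Longrightarrow> (A, B) \<in> \<T> \<or> (B, A) \<in> \<T>"
    "\<And>A\<^sub>1 B\<^sub>1 A\<^sub>2 B\<^sub>2 A\<^sub>3 B\<^sub>3. (A\<^sub>1, B\<^sub>1) \<in> \<T> \<Longrightarrow> (A\<^sub>2, B\<^sub>2) \<in> \<T> \<Longrightarrow> (A\<^sub>3, B\<^sub>3) \<in> \<T> \<Longrightarrow>
      graph_union (graph_union A\<^sub>1 A\<^sub>2) A\<^sub>3 \<noteq> G"
    "\<And>A B. (A, B) \<in> \<T> \<Longrightarrow> verts A \<noteq> verts G"
proof -
  show "(A, B) \<in> \<T> \<or> (B, A) \<in> \<T>" if "separation G A B" "sep_order A B < k" for A B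
  proof -
    have "sep_order A B \<le> k - 1"
      using that by simp
    then show ?thesis
      using assms that(1) unfolding tangle_def by blast
  qed
qed (use assms in \<open>unfold tangle_def, blast+\<close>)

lemma tangleI:
  assumes "1 \<le> k"
    "\<And>A B. (A, B) \<in> \<T> \<Longrightarrow> separation G A B"
    "\<And>A B. (A, B) \<in> \<T> \<Longrightarrow> sep_order A B < k"
    "\<And>A B. separation G A B \<Longrightarrow> sep_order A B < k \<Longrightarrow> (A, B) \<in> \<T> \<or> (B, A) \<in> \<T>"
    "\<And>A\<^sub>1 B\<^sub>1 A\<^sub>2 B\<^sub>2 A\<^sub>3 B\<^sub>3. (A\<^sub>1, B\<^sub>1) \<in> \<T> \<Longrightarrow> (A\<^sub>2, B\<^sub>2) \<in> \<T> \<Longrightarrow> (A\<^sub>3, B\<^sub>3) \<in> \<T> \<Longrightarrow>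
      graph_union (graph_union A\<^sub>1 A\<^sub>2) A\<^sub>3 \<noteq> G"
    "\<And>A B. (A, B) \<in> \<T> \<Longrightarrow> verts A \<noteq> verts G"
  shows "tangle G k \<T>"
proof -
  \<comment> \<open>Subtraction is truncated: for \<open>k = 0\<close> the bound
    \<open>k - 1\<close> would still admit order 0, so \<open>1 \<le> k\<close> enters here.\<close>
  have "sep_order A B < k" if "sep_order A B \<le> k - 1" for A B :: "'a ugraph"
    using that assms(1) by linarith
  then show ?thesis
    unfolding tangle_def using assms by blast
qed

text \<open>The lifted family consists of the separations of \<open>G\<close> whose restrictions to
  \<open>X\<close> belong to \<T>. Restricting does not raise the order, and a violated axiom in
  \<open>G\<close> would restrict to a violated one in \<open>induced G X\<close>. In the induction
  this passes the absence of tangles on to the sides of a separation.\<close>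

lemma rooted_tangle_lift:
  assumes G: "simple_graph G" and T: "rooted_tangle (induced G X) (S \<inter> X) k \<T>"
  shows "\<exists>\<T>'. rooted_tangle G S k \<T>'"
proof -
  let ?I = "induced G X"
  let ?r = "\<lambda>A. graph_inter A ?I"
  define \<T>' where "\<T>' = {(A, B). separation G A B \<and> sep_order A B < k \<and> (?r A, ?r B) \<in> \<T>}"
  have tg: "tangle ?I k \<T>" and root: "\<And>A B. (A, B) \<in> \<T> \<Longrightarrow> \<not> S \<inter> X \<subseteq> verts A"
    using T by (auto simp: rooted_tangle_def)
  have r: "separation ?I (?r A) (?r B)" "sep_order (?r A) (?r B) \<le> sep_order A B"
    if sep: "separation G A B" for A B
  proof -
    note D = separationD[OF sep]
    have fin: "finite (verts A \<inter> verts B)"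
      using D(1) by (simp add: simple_graph_def)
    have "edges A \<subseteq> edges G" "edges B \<subseteq> edges G" "verts A \<subseteq> verts G" "verts B \<subseteq> verts G"
      using D by auto
    moreover have simple: "simple_graph (?r C)"
      if C: "simple_graph C" "verts C \<subseteq> verts G" for C
      using C unfolding simple_graph_def graph_inter_def by auto
    ultimately show "separation ?I (?r A) (?r B)"
      using D by (intro separationI) (auto simp: graph_inter_def)
    show "sep_order (?r A) (?r B) \<le> sep_order A B"
      unfolding sep_order_def using fin by (intro card_mono) (auto simp: graph_inter_def)
  qed
  have "tangle G k \<T>'"
  proof (rule tangleI)
    show "1 \<le> k"
      using tangleD(1)[OF tg] .
  next
    fix A B
    assume "separation G A B" "sep_order A B < k"
    then show "(A, B) \<in> \<T>' \<or> (B, A) \<in> \<T>'"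
      using r[of A B] tangleD(4)[OF tg, of "?r A" "?r B"] separation_commute[of G A B]
      by (auto simp: \<T>'_def sep_order_commute[of B A])
  next
    fix A\<^sub>1 B\<^sub>1 A\<^sub>2 B\<^sub>2 A\<^sub>3 B\<^sub>3
    assume "(A\<^sub>1, B\<^sub>1) \<in> \<T>'" "(A\<^sub>2, B\<^sub>2) \<in> \<T>'" "(A\<^sub>3, B\<^sub>3) \<in> \<T>'"
    then have "graph_union (graph_union (?r A\<^sub>1) (?r A\<^sub>2)) (?r A\<^sub>3) \<noteq> ?I"
      using tangleD(5)[OF tg] by (auto simp: \<T>'_def)
    moreover have "graph_union (graph_union (?r A\<^sub>1) (?r A\<^sub>2)) (?r A\<^sub>3) =
        graph_inter (graph_union (graph_union A\<^sub>1 A\<^sub>2) A\<^sub>3) ?I"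
      by (auto simp: graph_union_def graph_inter_def)
    moreover have "graph_inter G ?I = ?I"
      by (auto simp: graph_inter_def induced_def)
    ultimately show "graph_union (graph_union A\<^sub>1 A\<^sub>2) A\<^sub>3 \<noteq> G"
      by auto
  next
    fix A B
    assume "(A, B) \<in> \<T>'"
    then have "verts (?r A) \<noteq> verts ?I"
      using tangleD(6)[OF tg] by (auto simp: \<T>'_def)
    then show "verts A \<noteq> verts G"
      by (auto simp: graph_inter_def)
  qed (auto simp: \<T>'_def)
  moreover have "\<not> S \<subseteq> verts A" if "(A, B) \<in> \<T>'" for A B
  proof -
    have "(?r A, ?r B) \<in> \<T>" "separation ?I (?r A) (?r B)"
      using that r by (auto simp: \<T>'_def)
    then have "\<not> S \<inter> X \<subseteq> verts (?r A)"
      using root by auto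
    moreover have "verts A \<subseteq> verts G"
      using that separationD(3)[of G A B] by (auto simp: \<T>'_def)
    ultimately show ?thesis
      by (auto simp: graph_inter_def)
  qed
  ultimately show ?thesis
    unfolding rooted_tangle_def by blast
qed

text \<open>The separations of order at most \<open>k\<close> with at most \<open>k\<close> vertices of \<open>Z\<close> on the first side
  form a tangle unless some separation splits \<open>Z\<close> well or cuts \<open>S\<close> off from \<open>Z\<close>: three first
  sides contain at most \<open>3 k\<close> vertices of \<open>Z\<close>.\<close>

lemma separation_if_no_tangle:
  assumes G: "simple_graph G" and S: "S \<subseteq> verts G" and Z: "Z \<subseteq> verts G" "card Z = 3 * k + 1"
    and no: "\<nexists>\<T>. rooted_tangle G S (Suc k) \<T>"
  obtains A B where "separation G A B" "sep_order A B \<le> k"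
    "k < card (Z \<inter> verts A) \<and> k < card (Z \<inter> verts B) \<or>
     S \<subseteq> verts A \<and> card (Z \<inter> verts A) \<le> k"
proof (rule ccontr)
  assume "\<not> thesis"
  with that have none: "\<not> (k < card (Z \<inter> verts A) \<and> k < card (Z \<inter> verts B) \<or>
      S \<subseteq> verts A \<and> card (Z \<inter> verts A) \<le> k)"
    if "separation G A B" "sep_order A B \<le> k" for A B
    using that by blast
  have split: "card (Z \<inter> verts A) \<le> k \<or> card (Z \<inter> verts B) \<le> k"
    and cut: "card (Z \<inter> verts A) \<le> k \<Longrightarrow> \<not> S \<subseteq> verts A"
    if "separation G A B" "sep_order A B \<le> k" for A B
    using none[OF that] by auto
  define \<T> where
    "\<T> = {(A, B). separation G A B \<and> sep_order A B \<le> k \<and> card (Z \<inter> verts A) \<le> k}"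
  have "tangle G (Suc k) \<T>"
  proof (rule tangleI)
    fix A B
    assume "separation G A B" "sep_order A B < Suc k"
    then show "(A, B) \<in> \<T> \<or> (B, A) \<in> \<T>"
      using split[of A B] by (auto simp: \<T>_def separation_commute sep_order_commute[of B A])
  next
    fix A\<^sub>1 B\<^sub>1 A\<^sub>2 B\<^sub>2 A\<^sub>3 B\<^sub>3
    assume "(A\<^sub>1, B\<^sub>1) \<in> \<T>" "(A\<^sub>2, B\<^sub>2) \<in> \<T>" "(A\<^sub>3, B\<^sub>3) \<in> \<T>"
    then have "card (Z \<inter> verts A\<^sub>1) \<le> k" "card (Z \<inter> verts A\<^sub>2) \<le> k" "card (Z \<inter> verts A\<^sub>3) \<le> k"
      by (auto simp: \<T>_def)
    moreover have "card (Z \<inter> verts A\<^sub>1 \<union> Z \<inter> verts A\<^sub>2 \<union> Z \<inter> verts A\<^sub>3) \<le>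
        card (Z \<inter> verts A\<^sub>1) + card (Z \<inter> verts A\<^sub>2) + card (Z \<inter> verts A\<^sub>3)"
      by (meson card_Un_le add_le_mono1 le_trans)
    ultimately have "Z \<inter> verts A\<^sub>1 \<union> Z \<inter> verts A\<^sub>2 \<union> Z \<inter> verts A\<^sub>3 \<noteq> Z"
      using Z(2) by auto
    then show "graph_union (graph_union A\<^sub>1 A\<^sub>2) A\<^sub>3 \<noteq> G"
      using Z(1) by (auto simp: graph_union_def)
  next
    fix A B
    assume "(A, B) \<in> \<T>"
    \<comment> \<open>A first side with all vertices would contain \<open>S\<close>, which
      \<open>cut\<close> excludes.\<close>
    then show "verts A \<noteq> verts G"
      using cut[of A B] S by (auto simp: \<T>_def)
  qed (auto simp: \<T>_def)
  then have "rooted_tangle G S (Suc k) \<T>"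
    using cut by (auto simp: rooted_tangle_def \<T>_def)
  then show False
    using no by blast
qed

lemma layout_if_no_tangle:
  assumes "simple_graph G" "S \<subseteq> verts G" "Z \<subseteq> verts G" "card Z \<le> 3 * k + 1"
    "\<nexists>\<T>. rooted_tangle G S (Suc k) \<T>"
  shows "layout G S Z (4 * k + 1)"
  using assms
proof (induction "card (verts G)" arbitrary: G S Z rule: less_induct)
  case less
  note G = less.prems(1) and S = less.prems(2) and no = less.prems(5)
  have fin: "finite (verts G)"
    using G by (simp add: simple_graph_def)
  show ?case
  proof (cases "card (verts G) \<le> 3 * k + 1")
    case True
    then have "layout G S (verts G) (4 * k + 1)"
      using G S by (intro layout_single) auto
    then show ?thesis
      using less.prems(3) by (rule layout_mono)
  next
    case False
    \<comment> \<open>The prescribed set is filled up to the exact size for which a separation is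
      provided.\<close>
    then obtain Y where Y: "Z \<subseteq> Y" "Y \<subseteq> verts G" "card Y = 3 * k + 1"
      using exists_subset_between[of Z "3 * k + 1" "verts G"] less.prems fin by auto
    obtain A B where sep: "separation G A B" "sep_order A B \<le> k"
      and AB: "k < card (Y \<inter> verts A) \<and> k < card (Y \<inter> verts B) \<or>
        S \<subseteq> verts A \<and> card (Y \<inter> verts A) \<le> k"
      using separation_if_no_tangle[OF G S Y(2,3) no] by metis
    note D = separationD[OF sep(1)]
    let ?A = "verts A" and ?B = "verts B"
    let ?X = "Y \<union> (?A \<inter> ?B)"
    have finA: "finite ?A" "finite ?B" "finite Y"
      using D(1,2) fin Y(2) finite_subset by (auto simp: simple_graph_def)
    have ord: "card (?A \<inter> ?B) \<le> k"
      using sep(2) by (simp add: sep_order_def)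
    have X: "?X \<subseteq> verts G" "card ?X \<le> 4 * k + 1"
      using Y D(3) ord card_Un_le[of Y "?A \<inter> ?B"] by auto
    \<comment> \<open>The induction hypothesis decomposes any proper side whose share of the new
      root bag \<open>?X\<close> is small enough to be prescribed.\<close>
    have rec: "layout (induced G C) (S \<inter> C) (?X \<inter> C) (4 * k + 1)"
      if "C \<subseteq> verts G" "C \<noteq> verts G" "card (?X \<inter> C) \<le> 3 * k + 1" for C
    proof (rule less.hyps)
      show "card (verts (induced G C)) < card (verts G)"
        using that fin by (auto intro!: psubset_card_mono)
      show "\<nexists>\<T>. rooted_tangle (induced G C) (S \<inter> C) (Suc k) \<T>"
        using no rooted_tangle_lift[OF G] by blast
    qed (use that S X G in \<open>auto simp: simple_graph_induced\<close>)
    have sum: "card Y + card (Y \<inter> (?A \<inter> ?B)) = card (Y \<inter> ?A) + card (Y \<inter> ?B)"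
    proof -
      have "Y \<inter> ?A \<union> Y \<inter> ?B = Y" "(Y \<inter> ?A) \<inter> (Y \<inter> ?B) = Y \<inter> (?A \<inter> ?B)"
        using Y(2) D(3) by auto
      then show ?thesis
        using card_Un_Int[of "Y \<inter> ?A" "Y \<inter> ?B"] finA by simp
    qed
    have card_X: "card (?X \<inter> C) + card (Y \<inter> (?A \<inter> ?B)) = card (Y \<inter> C) + card (?A \<inter> ?B)"
      if "?A \<inter> ?B \<subseteq> C" for C
    proof -
      have "?X \<inter> C = (Y \<inter> C) \<union> (?A \<inter> ?B)" "Y \<inter> (?A \<inter> ?B) = (Y \<inter> C) \<inter> (?A \<inter> ?B)"
        using that by auto
      then show ?thesis
        using card_Un_Int[of "Y \<inter> C" "?A \<inter> ?B"] finA by simp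
    qed
    \<comment> \<open>By inclusion and exclusion the share of \<open>?A\<close> in \<open>?X\<close>
      is \<open>3 k + 1\<close>, minus the size of \<open>Y \<inter> ?B\<close>, plus the order.
      This is at most \<open>3 k\<close> if \<open>?B\<close> has more than \<open>k\<close>
      vertices of \<open>Y\<close>; in the other case the share is at most
      \<open>k + k\<close>.\<close>
    have XA: "card (?X \<inter> ?A) \<le> 3 * k + 1"
      using AB sum card_X[of ?A] ord Y(3) by auto
    have "layout G S ?X (4 * k + 1)"
    proof (rule layout_glue[OF G D(3)])
      show "layout (induced G ?A) (S \<inter> ?A) (?X \<inter> ?A) (4 * k + 1)"
      proof (rule rec)
        \<comment> \<open>Otherwise \<open>?A\<close> contains all \<open>3 k + 1\<close> vertices
          of \<open>Y\<close> while \<open>Y \<inter> ?B\<close> lies in the separator, so both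
          alternatives fail.\<close>
        show "?A \<noteq> verts G"
        proof
          assume *: "?A = verts G"
          then have "Y \<inter> ?A = Y" "Y \<inter> ?B \<subseteq> ?A \<inter> ?B"
            using Y(2) by auto
          then have "card (Y \<inter> ?B) \<le> k"
            using ord card_mono[of "?A \<inter> ?B" "Y \<inter> ?B"] finA by auto
          then show False
            using AB \<open>Y \<inter> ?A = Y\<close> Y(3) by auto
        qed
      qed (use D(3) XA in auto)
      show "layout (induced G ?B) (S \<inter> ?B) (?X \<inter> ?B) (4 * k + 1)"
      proof (cases "S \<subseteq> ?A")
        \<comment> \<open>The side \<open>?B\<close> is discarded: the rest of \<open>S\<close> on
          it lies in the separator, so the single bag \<open>?X \<inter> ?B\<close>
          suffices.\<close>
        case True
        have "card (?X \<inter> ?B) \<le> 4 * k + 1"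
          using card_mono[of ?X "?X \<inter> ?B"] X(2) finA by auto
        then show ?thesis
          using True D(3) by (intro layout_single) (auto simp: simple_graph_induced[OF G])
      next
        case False
        then have k: "k < card (Y \<inter> ?A)" "k < card (Y \<inter> ?B)"
          using AB by auto
        show ?thesis
        proof (rule rec)
          show "?B \<noteq> verts G"
          proof
            assume "?B = verts G"
            then have "Y \<inter> ?A \<subseteq> ?A \<inter> ?B"
              using Y(2) by auto
            then show False
              using k ord card_mono[of "?A \<inter> ?B" "Y \<inter> ?A"] finA by auto
          qed
          show "card (?X \<inter> ?B) \<le> 3 * k + 1"
            using k sum card_X[of ?B] ord Y(3) by auto
        qed (use D(3) in auto)
      qed
    qed (use D(6) X S in auto)
    then show ?thesis
      by (rule layout_mono) (use Y(1) in auto)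
  qed
qed

section \<open>Leaves of trees\<close>

text \<open>The first vertex of a longest path is a leaf: a neighbour off the path would extend it,
  and a neighbour further along the path than the second vertex would close a cycle.\<close>

lemma tree_leaf:
  assumes T: "is_tree T" and x: "x \<in> verts T" "verts T \<noteq> {x}"
  obtains l m where "{l, m} \<in> edges T" "\<And>y. {l, y} \<in> edges T \<Longrightarrow> y = m"
proof -
  have simple: "simple_graph T" and con: "graph_connected T" and acyc: "\<And>vs. \<not> is_cycle T vs"
    using T by (auto simp: is_tree_def)
  define path where "path vs \<longleftrightarrow> distinct vs \<and> set vs \<subseteq> verts T \<and>
    (\<forall>i. Suc i < length vs \<longrightarrow> {vs ! i, vs ! Suc i} \<in> edges T)" for vs
  obtain y where y: "y \<in> verts T" "y \<noteq> x"
    using x by blast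
  then have "(x, y) \<in> (adj T)\<^sup>*"
    using con x by (auto simp: graph_connected_adj)
  then obtain z where z: "{x, z} \<in> edges T"
    using y(2) by (auto simp: adj_def elim: converse_rtranclE)
  have path2: "path [x, z]"
    using simple_graph_edgeD[OF simple z] z by (auto simp: path_def)
  have bound: "length vs \<le> card (verts T)" if "path vs" for vs
    using that simple card_mono[of "verts T" "set vs"]
    by (auto simp: path_def simple_graph_def distinct_card)
  then have "\<forall>vs. path vs \<longrightarrow> length vs < Suc (card (verts T))"
    by (simp add: less_Suc_eq_le)
  then obtain vs where vs: "path vs" and max: "\<And>us. path us \<Longrightarrow> length us \<le> length vs"
    using ex_has_greatest_nat[of path "[x, z]" length] path2 by blast
  have len: "2 \<le> length vs"
    using max[OF path2] by simp
  have d: "distinct vs" "set vs \<subseteq> verts T"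
    and e: "\<And>i. Suc i < length vs \<Longrightarrow> {vs ! i, vs ! Suc i} \<in> edges T"
    using vs by (auto simp: path_def)
  show ?thesis
  proof (rule that)
    show "{vs ! 0, vs ! 1} \<in> edges T"
      using e[of 0] len by simp
    fix y
    assume y: "{vs ! 0, y} \<in> edges T"
    have "y \<in> set vs"
    proof (rule ccontr)
      assume "y \<notin> set vs"
      moreover have "{(y # vs) ! i, (y # vs) ! Suc i} \<in> edges T" if "Suc i < length (y # vs)" for i
        using that y e by (cases i) (auto simp: insert_commute)
      ultimately have "path (y # vs)"
        using simple_graph_edgeD[OF simple y] d unfolding path_def by auto
      then show False
        using max by fastforce
    qed
    then obtain j where j: "j < length vs" "vs ! j = y"
      by (auto simp: in_set_conv_nth)
    have "j \<noteq> 0"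
      using j simple_graph_edgeD(3)[OF simple y] by metis
    moreover have "\<not> 2 \<le> j"
    proof
      assume j2: "2 \<le> j"
      let ?c = "take (Suc j) vs"
      have lc: "length ?c = Suc j"
        using j by simp
      have "{?c ! i, ?c ! (Suc i mod Suc j)} \<in> edges T" if "i < Suc j" for i
      proof (cases "i = j")
        case True
        then show ?thesis
          using y j by (simp add: insert_commute)
      next
        case False
        then show ?thesis
          using that e[of i] j by simp
      qed
      then have "is_cycle T ?c"
        unfolding is_cycle_def lc using j2 d by simp
      then show False
        using acyc by blast
    qed
    ultimately have "j = 1"
      by linarith
    then show "y = vs ! 1"
      using j by simp
  qed
qed

text \<open>A walk can enter and leave \<open>l\<close> only through \<open>m\<close>, so the detour
  can be cut out. Since \<open>leaf\<close> only forbids other neighbours, the lemma also applies to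
  induced subgraphs from which \<open>l\<close> may be missing.\<close>

lemma graph_connected_delete_leaf:
  assumes simple: "simple_graph T" and con: "graph_connected T"
    and leaf: "\<And>y. {l, y} \<in> edges T \<Longrightarrow> y = m" and ne: "verts T \<noteq> {l}"
  shows "graph_connected (induced T (verts T - {l}))" and "l \<in> verts T \<Longrightarrow> m \<in> verts T"
proof -
  let ?T = "induced T (verts T - {l})"
  \<comment> \<open>The invariant replaces the position \<open>l\<close> by \<open>m\<close>, so
    that the walk being followed never leaves \<open>?T\<close>.\<close>
  have avoid: "(w \<noteq> l \<longrightarrow> (u, w) \<in> (adj ?T)\<^sup>*) \<and> (w = l \<longrightarrow> (u, m) \<in> (adj ?T)\<^sup>*)"
    if "(u, w) \<in> (adj T)\<^sup>*" "u \<noteq> l" for u w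
    using that(1)
  proof (induction rule: rtrancl_induct)
    case base
    then show ?case
      using that(2) by simp
  next
    case (step y z)
    have yz: "{y, z} \<in> edges T" "{z, y} \<in> edges T"
      using step.hyps by (auto simp: adj_def insert_commute)
    note V = simple_graph_edgeD[OF simple yz(1)]
    show ?case
    proof (cases "y = l \<or> z = l")
      case True
      then show ?thesis
        using leaf yz V(3) step.IH by metis
    next
      case False
      then have "(y, z) \<in> adj ?T"
        using yz V by (auto simp: adj_def)
      then show ?thesis
        using False step.IH by (meson rtrancl_into_rtrancl)
    qed
  qed
  obtain x where x: "x \<in> verts T" "x \<noteq> l"
    using con ne by (auto simp: graph_connected_adj)
  show "graph_connected ?T"
    unfolding graph_connected_adj
  proof (intro conjI ballI)
    show "verts ?T \<noteq> {}"
      using x by auto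
    fix u v
    assume "u \<in> verts ?T" "v \<in> verts ?T"
    then have "u \<noteq> l" "v \<noteq> l" "(u, v) \<in> (adj T)\<^sup>*"
      using con by (auto simp: graph_connected_adj)
    then show "(u, v) \<in> (adj ?T)\<^sup>*"
      using avoid by blast
  qed
  assume "l \<in> verts T"
  then have "(l, x) \<in> (adj T)\<^sup>*"
    using con x by (auto simp: graph_connected_adj)
  then obtain y where "{l, y} \<in> edges T"
    using x(2) by (auto simp: adj_def elim: converse_rtranclE)
  then show "m \<in> verts T"
    using leaf simple_graph_edgeD(2)[OF simple] by blast
qed

lemma is_tree_delete_leaf:
  assumes T: "is_tree T" and leaf: "\<And>y. {l, y} \<in> edges T \<Longrightarrow> y = m" and ne: "verts T \<noteq> {l}"
  shows "is_tree (induced T (verts T - {l}))"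
proof -
  have "\<not> is_cycle (induced T U) vs" for U vs
    using T by (auto simp: is_tree_def is_cycle_def)
  then show ?thesis
    using T graph_connected_delete_leaf(1)[OF _ _ leaf ne]
    by (auto simp: is_tree_def simple_graph_induced)
qed

section \<open>Tangles and decompositions\<close>

text \<open>Giving the first side all its edges turns smallness into a property of vertex
  sets.\<close>

definition small :: "'a ugraph \<Rightarrow> ('a ugraph \<times> 'a ugraph) set \<Rightarrow> 'a set \<Rightarrow> bool" where
  "small G \<T> X \<longleftrightarrow> X \<subseteq> verts G \<and> (\<exists>B. (induced G X, B) \<in> \<T>)"

text \<open>The edges inside \<open>A \<inter> B\<close> go to the first side only, as the two edge
  sets must be disjoint.\<close>

lemma separation_induced:
  assumes G: "simple_graph G" and AB: "A \<union> B = verts G"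
    and E: "\<And>e. e \<in> edges G \<Longrightarrow> e \<subseteq> A \<or> e \<subseteq> B"
  shows "separation G (induced G A) \<lparr>verts = B, edges = {e \<in> edges G. \<not> e \<subseteq> A}\<rparr>"
proof (rule separationI)
  have "finite B"
    using G AB by (metis finite_Un simple_graph_def)
  then show "simple_graph \<lparr>verts = B, edges = {e \<in> edges G. \<not> e \<subseteq> A}\<rparr>"
    using G E by (auto simp: simple_graph_def)
qed (use G AB in \<open>auto simp: simple_graph_induced\<close>)

text \<open>Neither \<open>G[A]\<close> nor \<open>G[B]\<close> being small would make both sides small after removal of the
  edges inside \<open>A \<inter> B\<close>, and those edges form a third small side.\<close>

lemma small_dichotomy:
  assumes G: "simple_graph G" and tg: "tangle G k \<T>" and AB: "A \<union> B = verts G"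
    and E: "\<And>e. e \<in> edges G \<Longrightarrow> e \<subseteq> A \<or> e \<subseteq> B" and ord: "card (A \<inter> B) < k"
  shows "small G \<T> A \<or> small G \<T> B"
proof (rule ccontr)
  assume no: "\<not> (small G \<T> A \<or> small G \<T> B)"
  let ?r = "\<lambda>X Y. \<lparr>verts = Y, edges = {e \<in> edges G. \<not> e \<subseteq> X}\<rparr>"
  let ?C = "A \<inter> B"
  have eV: "e \<subseteq> verts G" if "e \<in> edges G" for e
    using that G by (simp add: simple_graph_def)
  have dich: "(induced G X, ?r X Y) \<in> \<T> \<or> (?r X Y, induced G X) \<in> \<T>"
    if "X \<union> Y = verts G" "\<And>e. e \<in> edges G \<Longrightarrow> e \<subseteq> X \<or> e \<subseteq> Y" "card (X \<inter> Y) < k" for X Y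
  proof (rule tangleD(4)[OF tg separation_induced[OF G that(1,2)]])
    have "verts G \<inter> X \<inter> Y = X \<inter> Y"
      using that(1) by auto
    then show "sep_order (induced G X) (?r X Y) < k"
      using that(3) by (simp add: sep_order_def)
  qed
  have "(?r A B, induced G A) \<in> \<T>"
    using dich[of A B] AB E ord no by (auto simp: small_def)
  moreover have "(?r B A, induced G B) \<in> \<T>"
  proof -
    have "B \<union> A = verts G" "\<And>e. e \<in> edges G \<Longrightarrow> e \<subseteq> B \<or> e \<subseteq> A" "card (B \<inter> A) < k"
      using AB E ord by (auto simp: Int_commute)
    then show ?thesis
      using dich[of B A] no AB by (auto simp: small_def)
  qed
  \<comment> \<open>The opposite orientation is impossible, since its first side has all vertices of
    \<open>G\<close>.\<close>
  moreover have "(induced G ?C, ?r ?C (verts G)) \<in> \<T>"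
  proof -
    have C: "?C \<union> verts G = verts G" "?C \<inter> verts G = ?C"
      using AB by auto
    have "(induced G ?C, ?r ?C (verts G)) \<in> \<T> \<or> (?r ?C (verts G), induced G ?C) \<in> \<T>"
      using dich[of ?C "verts G"] eV ord C by simp
    then show ?thesis
      using tangleD(6)[OF tg, of "?r ?C (verts G)"] by auto
  qed
  ultimately have "graph_union (graph_union (?r A B) (?r B A)) (induced G ?C) \<noteq> G"
    by (rule tangleD(5)[OF tg])
  moreover have "B \<union> A \<union> verts G \<inter> ?C = verts G"
    using AB by auto
  moreover have "{e \<in> edges G. \<not> e \<subseteq> A} \<union> {e \<in> edges G. \<not> e \<subseteq> B} \<union>
      {e \<in> edges G. e \<subseteq> ?C} = edges G"
    by auto
  ultimately show False
    by (cases G) (simp add: graph_union_def)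
qed

text \<open>If the union were not small, the dichotomy would make \<open>B\<close> small. Then
  \<open>X\<close>, \<open>Y\<close> and \<open>B\<close> would give three first sides covering
  \<open>G\<close>.\<close>

lemma small_Un:
  assumes G: "simple_graph G" and tg: "tangle G k \<T>" and small: "small G \<T> X" "small G \<T> Y"
    and B: "X \<union> Y \<union> B = verts G" "card ((X \<union> Y) \<inter> B) < k"
    and E: "\<And>e. e \<in> edges G \<Longrightarrow> e \<subseteq> X \<or> e \<subseteq> Y \<or> e \<subseteq> B"
  shows "small G \<T> (X \<union> Y)"
proof (rule ccontr)
  assume "\<not> small G \<T> (X \<union> Y)"
  moreover have "small G \<T> (X \<union> Y) \<or> small G \<T> B"
    using G tg B(1) _ B(2) by (rule small_dichotomy) (use E in blast)
  ultimately obtain X' Y' B' where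
    "(induced G X, X') \<in> \<T>" "(induced G Y, Y') \<in> \<T>" "(induced G B, B') \<in> \<T>"
    using small by (auto simp: small_def)
  then have "graph_union (graph_union (induced G X) (induced G Y)) (induced G B) \<noteq> G"
    by (rule tangleD(5)[OF tg])
  moreover have "verts G \<inter> X \<union> verts G \<inter> Y \<union> verts G \<inter> B = verts G"
    using B(1) by auto
  moreover have "{e \<in> edges G. e \<subseteq> X} \<union> {e \<in> edges G. e \<subseteq> Y} \<union> {e \<in> edges G. e \<subseteq> B} = edges G"
    using E by auto
  ultimately show False
    by (cases G) (simp add: graph_union_def)
qed

lemma induced_induced: "induced (induced G X) Y = induced G (X \<inter> Y)"
  by (simp add: induced_def Int_assoc conj_assoc)

text \<open>A leaf \<open>l\<close> with neighbour \<open>m\<close> can be deleted: \<open>W l - W m\<close> and everything attached to \<open>l\<close>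
  become attached to \<open>m\<close>, and the part belonging to \<open>m\<close> remains small as its separator is
  contained in \<open>W m\<close>. This eventually makes the whole graph small.\<close>

lemma no_small_framing:
  assumes "simple_graph G" "tangle G k \<T>" "is_tree T" "framing G U (verts T) W f"
    "\<And>v. v \<in> U \<Longrightarrow> graph_connected (induced T {x \<in> verts T. v \<in> W x})"
    "\<And>x. x \<in> verts T \<Longrightarrow> card (W x) < k"
    "\<And>x. x \<in> verts T \<Longrightarrow> small G \<T> (W x \<union> {u \<in> verts G - U. f u = x})"
  shows False
  using assms(3-)
proof (induction "card (verts T)" arbitrary: T U f rule: less_induct)
  case less
  note G = assms(1) and tg = assms(2) and T = less.prems(1) and con = less.prems(3)
    and card = less.prems(4) and small = less.prems(5)
  note F = framingD[OF less.prems(2)]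
  have simple: "simple_graph T"
    using T by (simp add: is_tree_def)
  then have finT: "finite (verts T)"
    by (simp add: simple_graph_def)
  obtain x where x: "x \<in> verts T"
    using T by (auto simp: is_tree_def graph_connected_adj)
  show False
  proof (cases "verts T = {x}")
    case True
    \<comment> \<open>With one node left, every vertex of \<open>U\<close> lies in its bag and every
      other vertex has its label. The small set at this node is then the whole vertex set, which no
      first side can be.\<close>
    have "U \<subseteq> W x"
    proof
      fix v
      assume "v \<in> U"
      then show "v \<in> W x"
        using con[of v] True by (auto simp: graph_connected_adj)
    qed
    then have all: "W x \<union> {u \<in> verts G - U. f u = x} = verts G"
      using F(1) F(2)[OF x] F(4) True by auto
    obtain B where "(induced G (verts G), B) \<in> \<T>"
      using small[OF x] unfolding all small_def by blast
    then show False
      using tangleD(6)[OF tg] by fastforce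
  next
    case False
    then obtain l m where lm: "{l, m} \<in> edges T" and leaf: "\<And>y. {l, y} \<in> edges T \<Longrightarrow> y = m"
      using tree_leaf[OF T x] by metis
    note lmV = simple_graph_edgeD[OF simple lm]
    then have ne: "verts T \<noteq> {l}"
      by auto
    let ?T = "induced T (verts T - {l})"
    \<comment> \<open>The bags containing \<open>v\<close> form a connected set. If it contained a
      node besides \<open>l\<close>, it would also contain \<open>m\<close>, the only neighbour of
      \<open>l\<close>.\<close>
    have only: "x = l" if "v \<in> W l" "v \<notin> W m" "x \<in> verts T" "v \<in> W x" for v x
    proof (rule ccontr)
      assume "x \<noteq> l"
      let ?V = "induced T {x \<in> verts T. v \<in> W x}"
      have "v \<in> U"
        using F(2) that by auto
      moreover have "l \<in> verts ?V" "verts ?V \<noteq> {l}"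
        using that lmV \<open>x \<noteq> l\<close> by auto
      ultimately have "m \<in> verts ?V"
        using graph_connected_delete_leaf(2)[OF simple_graph_induced[OF simple] con, of v l m] leaf
        by auto
      then show False
        using that by auto
    qed
    \<comment> \<open>Together with the next fact: neighbours of a vertex private to
      \<open>W l\<close> stay in \<open>W l\<close> or carry the label \<open>l\<close>. So these
      vertices and the remainder at \<open>l\<close> can be moved to \<open>m\<close> as a
      whole.\<close>
    have edge_l: "v \<in> W l" if uv: "{u, v} \<in> edges G" "u \<in> W l" "u \<notin> W m" "v \<in> U" for u v
    proof -
      have "{u, v} \<subseteq> U"
        using uv F(2)[OF lmV(1)] by auto
      then obtain i where "i \<in> verts T" "{u, v} \<subseteq> W i"
        using F(3)[OF uv(1)] by blast
      then show ?thesis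
        using only[OF uv(2,3)] by auto
    qed
    have edge_l': "f v = l" if "{u, v} \<in> edges G" "u \<in> W l" "u \<notin> W m" "v \<notin> U" for u v
    proof -
      have "{v, u} \<in> edges G" "u \<in> U"
        using that F(2)[OF lmV(1)] by (auto simp: insert_commute)
      then have "u \<in> W (f v)" "f v \<in> verts T"
        using F(4,5) that(4) simple_graph_edgeD[OF G] by blast+
      then show ?thesis
        using only[OF that(2,3)] by blast
    qed
    let ?K = "\<lambda>x. {u \<in> verts G - U. f u = x}"
    define U' where "U' = U - (W l - W m)"
    define f' where "f' u = (if u \<in> U \<or> f u = l then m else f u)" for u
    have "framing G U' (verts ?T) W f'"
      unfolding framing_def
    proof (intro conjI ballI allI impI)
      show "U' \<subseteq> verts G"
        using F(1) by (auto simp: U'_def)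
      show "W i \<subseteq> U'" if "i \<in> verts ?T" for i
        using that F(2)[of i] only[of _ i] by (auto simp: U'_def)
      show "\<exists>i\<in>verts ?T. e \<subseteq> W i" if e: "e \<in> edges G" "e \<subseteq> U'" for e
      proof -
        obtain i where i: "i \<in> verts T" "e \<subseteq> W i"
          using F(3)[OF e(1)] e(2) by (auto simp: U'_def)
        show ?thesis
        proof (cases "i = l")
          case True
          then have "e \<subseteq> W m"
            using i e by (auto simp: U'_def)
          then show ?thesis
            using lmV by auto
        qed (use i in auto)
      qed
      show "f' u \<in> verts ?T" if "u \<in> verts G - U'" for u
        using that lmV F(4)[of u] by (auto simp: f'_def)
      show "if v \<in> U' then v \<in> W (f' u) else f' v = f' u"
        if uv: "{u, v} \<in> edges G" and u: "u \<notin> U'" for u v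
      proof (cases "u \<in> U")
        case True
        then have u': "u \<in> W l" "u \<notin> W m"
          using u by (auto simp: U'_def)
        show ?thesis
          using True edge_l[OF uv u'] edge_l'[OF uv u'] by (auto simp: f'_def U'_def)
      next
        case uU: False
        have fu: "f u \<in> verts T"
          using F(4) simple_graph_edgeD[OF G uv] uU by blast
        show ?thesis
        proof (cases "f u = l")
          case True
          then show ?thesis
            using F(5,6)[OF uv uU] by (auto simp: f'_def U'_def)
        next
          case False
          then have "v \<in> U' \<and> v \<in> W (f u)" if "v \<in> U"
            using that F(5)[OF uv uU that] only[OF _ _ fu] by (auto simp: U'_def)
          then show ?thesis
            using False F(6)[OF uv uU] uU by (cases "v \<in> U") (auto simp: f'_def U'_def)
        qed
      qed
    qed
    moreover have "graph_connected (induced ?T {x \<in> verts ?T. v \<in> W x})" if v: "v \<in> U'" for v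
    proof -
      let ?V = "induced T {x \<in> verts T. v \<in> W x}"
      \<comment> \<open>A vertex occurring only in \<open>W l\<close> is private to \<open>l\<close>
        and has been removed from \<open>U'\<close>.\<close>
      have "verts ?V \<noteq> {l}"
      proof
        assume *: "verts ?V = {l}"
        then have "l \<in> verts ?V" "m \<notin> verts ?V"
          using lmV(3) by auto
        then show False
          using v lmV by (auto simp: U'_def)
      qed
      then have "graph_connected (induced ?V (verts ?V - {l}))"
        using v leaf con simple by (intro graph_connected_delete_leaf(1)[of _ _ m])
          (auto simp: U'_def simple_graph_induced)
      moreover have "{x \<in> verts T. v \<in> W x} \<inter> (verts ?V - {l}) =
          (verts T - {l}) \<inter> {x \<in> verts ?T. v \<in> W x}"
        by auto
      ultimately show ?thesis
        by (simp only: induced_induced)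
    qed
    moreover have "small G \<T> (W x \<union> {u \<in> verts G - U'. f' u = x})" if x: "x \<in> verts ?T" for x
    proof (cases "x = m")
      case True
      let ?K' = "{u \<in> verts G - U'. f' u = m}"
      have K': "?K' = (W l - W m) \<union> ?K l \<union> ?K m"
        using F(1) F(2)[OF lmV(1)] by (auto simp: f'_def U'_def)
      have Wm: "W m \<subseteq> U'"
        using F(2)[OF lmV(2)] by (auto simp: U'_def)
      have eq: "W m \<union> ?K' = (W m \<union> ?K m) \<union> (W l \<union> ?K l)"
        unfolding K' by auto
      \<comment> \<open>The third part for \<open>small_Un\<close> is everything outside the new
        remainder of \<open>m\<close>. It meets the union exactly in \<open>W m\<close>, so the
        order is below \<open>k\<close>.\<close>
      have "small G \<T> ((W m \<union> ?K m) \<union> (W l \<union> ?K l))"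
      proof (rule small_Un[OF G tg small[OF lmV(2)] small[OF lmV(1)]])
        show "W m \<union> ?K m \<union> (W l \<union> ?K l) \<union> (verts G - ?K') = verts G"
          using F(1) F(2)[OF lmV(2)] unfolding eq[symmetric] by auto
        have "(W m \<union> ?K m \<union> (W l \<union> ?K l)) \<inter> (verts G - ?K') = W m"
          using F(1) Wm unfolding eq[symmetric] by (auto simp: U'_def)
        then show "card ((W m \<union> ?K m \<union> (W l \<union> ?K l)) \<inter> (verts G - ?K')) < k"
          using card[OF lmV(2)] by simp
        fix e
        assume e: "e \<in> edges G"
        have outside: "{u, v} \<subseteq> W y \<union> ?K y" if "{u, v} \<in> edges G" "u \<in> ?K y" for u v y
          using that F(5,6)[OF that(1)] simple_graph_edgeD[OF G that(1)] by auto
        show "e \<subseteq> W m \<union> ?K m \<or> e \<subseteq> W l \<union> ?K l \<or> e \<subseteq> verts G - ?K'"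
        proof (cases "e \<subseteq> verts G - ?K'")
          case False
          have "e \<subseteq> verts G"
            using G e by (simp add: simple_graph_def)
          then obtain u where u: "u \<in> e" "u \<in> ?K'"
            using False by blast
          then obtain v where ev: "e = {u, v}"
            using simple_graph_edge_obtain[OF G e] by (metis insertE insert_commute singletonD)
          have uv: "{u, v} \<in> edges G"
            using e ev by simp
          from u(2) consider "u \<in> W l" "u \<notin> W m" | "u \<in> ?K l" | "u \<in> ?K m"
            unfolding K' by blast
          then show ?thesis
          proof cases
            case 1
            then have "v \<in> W l \<union> ?K l"
              using edge_l[OF uv] edge_l'[OF uv] simple_graph_edgeD[OF G uv] by auto
            then show ?thesis
              using 1 ev by auto
          next
            case 2
            then show ?thesis
              using outside[OF uv] ev by blast
          next
            case 3
            then show ?thesis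
              using outside[OF uv] ev by blast
          qed
        qed simp
      qed
      then show ?thesis
        unfolding True eq .
    next
      case False
      then have "{u \<in> verts G - U'. f' u = x} = ?K x"
        using x by (auto simp: f'_def U'_def)
      then show ?thesis
        using small x by simp
    qed
    moreover have "card (verts ?T) < card (verts T)"
      using finT lmV(1) by (intro psubset_card_mono) auto
    moreover have "is_tree ?T"
      using T leaf ne by (rule is_tree_delete_leaf)
    ultimately show False
      using less.hyps[of ?T U' f'] card by simp
  qed
qed

lemma rooted_tangle_le_width:
  assumes G: "simple_graph G" and tg: "rooted_tangle G S k \<T>"
    and dec: "rooted_tree_decomposition G S T W"
  shows "int k - 1 \<le> width T W"
proof -
  obtain U f where fr: "framing G U (verts T) W f" and SU: "S \<subseteq> U" and T: "is_tree T"
    and sub: "\<And>v. v \<in> U \<Longrightarrow> is_tree (induced T {x \<in> verts T. v \<in> W x})"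
    using rooted_tree_decomposition_framing[OF G dec] by metis
  note F = framingD[OF fr]
  have tangle: "tangle G k \<T>" and root: "\<And>A B. (A, B) \<in> \<T> \<Longrightarrow> \<not> S \<subseteq> verts A"
    using tg by (auto simp: rooted_tangle_def)
  have "\<exists>x\<in>verts T. k \<le> card (W x)"
  proof (rule ccontr)
    assume "\<not> ?thesis"
    then have bag: "card (W x) < k" if "x \<in> verts T" for x
      using that not_le by blast
    have "small G \<T> (W x \<union> {u \<in> verts G - U. f u = x})" if x: "x \<in> verts T" for x
    proof -
      let ?K = "{u \<in> verts G - U. f u = x}"
      let ?A = "W x \<union> ?K" and ?B = "verts G - ?K"
      have "small G \<T> ?A \<or> small G \<T> ?B"
        using G tangle
      proof (rule small_dichotomy)
        show "?A \<union> ?B = verts G"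
          using F(1) F(2)[OF x] by auto
        have "?A \<inter> ?B = W x"
          using F(1) F(2)[OF x] by auto
        then show "card (?A \<inter> ?B) < k"
          using bag[OF x] by simp
        show "e \<subseteq> ?A \<or> e \<subseteq> ?B" if e: "e \<in> edges G" for e
        proof -
          obtain u v where uv: "e = {u, v}" "u \<in> verts G" "v \<in> verts G"
            using simple_graph_edge_obtain[OF G e] by metis
          moreover have "{u, v} \<in> edges G" "{v, u} \<in> edges G"
            using e uv by (auto simp: insert_commute)
          ultimately show ?thesis
            using F(5,6)[of u v] F(5,6)[of v u] by blast
        qed
      qed
      \<comment> \<open>The remainder is disjoint from \<open>U\<close> and hence from
        \<open>S\<close>, so the rooted tangle cannot have \<open>?B\<close> as a small
        side.\<close>
      moreover have "S \<subseteq> verts (induced G ?B)"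
        using SU F(1) by auto
      then have "\<not> small G \<T> ?B"
        using root unfolding small_def by blast
      ultimately show ?thesis
        by blast
    qed
    then show False
      using no_small_framing[OF G tangle T fr _ bag] sub by (simp add: is_tree_def)
  qed
  then obtain x where x: "x \<in> verts T" "k \<le> card (W x)"
    by blast
  have "finite (verts T)"
    using T by (simp add: is_tree_def simple_graph_def)
  then have "int (card (W x)) \<le> Max ((\<lambda>x. int (card (W x))) ` verts T)"
    using x(1) by (intro Max_ge) auto
  then show ?thesis
    using x(2) by (simp add: width_def)
qed

section \<open>Tangle number and tree-width\<close>

lemma finite_rooted_tangle_orders:
  assumes "simple_graph G"
  shows "finite (insert 0 {k. \<exists>\<T>. rooted_tangle G S k \<T>})"
proof -
  have "insert 0 {k. \<exists>\<T>. rooted_tangle G S k \<T>} \<subseteq> {..card (verts G)}"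
    using tangle_order_le_card[OF assms] by (auto simp: rooted_tangle_def)
  then show ?thesis
    by (rule finite_subset) simp
qed

theorem theorem3p6:
  fixes G :: "'a ugraph" and S :: "'a set"
  assumes "simple_graph G" and "verts G \<noteq> {}" and "S \<subseteq> verts G"
  shows "int (tangle_number G S) - 1 \<le> treewidth G S \<and>
         treewidth G S \<le> 10 * int (max (tangle_number G S) 2) - 12"
proof
  let ?K = "insert 0 {k. \<exists>\<T>. rooted_tangle G S k \<T>}"
  let ?X = "{w. \<exists>(T :: nat ugraph) W. rooted_tree_decomposition G S T W \<and> w = width T W}"
  have fin: "finite ?K"
    using assms(1) by (rule finite_rooted_tangle_orders)
  have "finite ?X"
    using assms(1) by (rule finite_rooted_tree_decomposition_widths)
  moreover have "?X \<noteq> {}"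
    using ex_rooted_tree_decomposition[OF assms(1,3)] by blast
  ultimately have "treewidth G S \<in> ?X"
    unfolding treewidth_def by (rule Min_in)
  then obtain T :: "nat ugraph" and W
    where dec: "rooted_tree_decomposition G S T W" and w: "treewidth G S = width T W"
    by blast
  have "tangle_number G S \<in> ?K"
    unfolding tangle_number_def using fin by (rule Max_in) simp
  then consider "tangle_number G S = 0" | \<T> where "rooted_tangle G S (tangle_number G S) \<T>"
    by auto
  then show "int (tangle_number G S) - 1 \<le> treewidth G S"
  proof cases
    \<comment> \<open>The value 0 comes without a tangle, and the claim becomes the general lower
      bound -1 for widths.\<close>
    case 1
    then show ?thesis
      using rooted_tree_decomposition_width_bounds(1)[OF assms(1) dec] w by simp
  next
    case 2
    then show ?thesis
      using rooted_tangle_le_width[OF assms(1) _ dec] w by simp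
  qed
  \<comment> \<open>Bags of size at most \<open>4 k + 1\<close> give width at most
    \<open>4 k\<close>, and \<open>4 k \<le> 10 k - 12\<close> amounts to
    \<open>k \<ge> 2\<close>.\<close>
  let ?k = "max (tangle_number G S) 2"
  have "\<nexists>\<T>. rooted_tangle G S (Suc ?k) \<T>"
  proof
    assume "\<exists>\<T>. rooted_tangle G S (Suc ?k) \<T>"
    then have "Suc ?k \<le> tangle_number G S"
      unfolding tangle_number_def using fin by (intro Max_ge) auto
    then show False
      by simp
  qed
  then have "layout G S {} (4 * ?k + 1)"
    using assms by (intro layout_if_no_tangle) auto
  then have "treewidth G S \<le> 4 * int ?k"
    using layout_treewidth[OF assms(1)] by fastforce
  then show "treewidth G S \<le> 10 * int ?k - 12"
    by simp
qed

end
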